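(* Let $\Gamma\subset\mathbb{R}^d$ be a closed, solid, acute convex cone and let $\mu$ be a finite positive measure supported on the polar cone $\Gamma^\ast$. For every $y\in\Gamma$ there exists a phase function $\xi_y\in L^1([0,\infty),dt)$, $0\le\xi_y\le1$, measurably depending on $y$, such that $$ 1+\int_{\Gamma^\ast}\frac{d\mu(x)}{x\cdot y-z}=\exp\int_0^\infty\frac{\xi_y(t)\,dt}{t-z},\qquad \operatorname{Im} z>0. $$ Moreover, if $\int_{\Gamma^\ast}|x|^n\,d\mu(x)<\infty$ for some $n\in\mathbb{N}$, then $\int_0^\infty t^n\xi_y(t)\,dt<\infty$ for all $y\in\Gamma$.
   Context: A convex cone is solid if it has nonempty interior, and acute if its closure contains no full line. The polar cone of $\Gamma$ is $\Gamma^\ast=\{x\in\mathbb{R}^d:\ \omega\cdot x\ge0\text{ for all }\omega\in\Gamma\}$. "Measurably depending on $y$" means that the map $y\mapsto\xi_y$ from $\Gamma$ to $L^1([0,\infty),dt)$ is weakly measurable, i.e. $y\mapsto\int_0^\infty \xi_y(t)g(t)\,dt$ is measurable for every $g\in L^\infty([0,\infty))$. *)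

theory Defs
  imports "HOL-Analysis.Analysis"
begin

definition solid :: "'a::topological_space set \<Rightarrow> bool"
  where "solid S \<longleftrightarrow> interior S \<noteq> {}"

definition acute :: "'a::real_normed_vector set \<Rightarrow> bool"
  where "acute S \<longleftrightarrow> \<not> (\<exists>a v. v \<noteq> 0 \<and> range (\<lambda>s::real. a + s *\<^sub>R v) \<subseteq> closure S)"

text \<open>Sign convention: this is the cone of vectors having nonnegative, not nonpositive,
  inner product with every element of the given cone.\<close>

definition polar_cone :: "'a::real_inner set \<Rightarrow> 'a set"
  where "polar_cone S = {x. \<forall>w\<in>S. 0 \<le> w \<bullet> x}"

text \<open>Elements of \<open>L\<^sup>1\<close> and \<open>L\<^sup>\<infinity>\<close> of the half-line are represented by functions
  on the whole real line; their values at negative arguments play no role.\<close>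

abbreviation half_line :: "real measure"
  where "half_line \<equiv> lebesgue_on {0..}"

definition L_infinity :: "'a measure \<Rightarrow> ('a \<Rightarrow> real) set"
  where "L_infinity M = {g \<in> borel_measurable M. \<exists>C. AE t in M. \<bar>g t\<bar> \<le> C}"

text \<open>The bounds hold everywhere on the half-line, not just almost everywhere: every element of
  \<open>L\<^sup>1\<close> satisfying them almost everywhere has such a representative.\<close>

definition phase_function :: "(real \<Rightarrow> real) \<Rightarrow> bool"
  where "phase_function \<xi> \<longleftrightarrow>
    integrable half_line \<xi> \<and> (\<forall>t\<ge>0. 0 \<le> \<xi> t \<and> \<xi> t \<le> 1)"

definition weakly_measurable_on ::
    "'a::topological_space set \<Rightarrow> ('a \<Rightarrow> real \<Rightarrow> real) \<Rightarrow> bool"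
  where "weakly_measurable_on S \<xi> \<longleftrightarrow>
    (\<forall>g\<in>L_infinity half_line.
       (\<lambda>y. LINT t|half_line. \<xi> y t * g t) \<in> borel_measurable (restrict_space borel S))"

end

theory Submission
  imports Defs
    "HOL-Computational_Algebra.Polynomial_FPS"
    "HOL-Complex_Analysis.Cauchy_Integral_Theorem"
    "HOL-Probability.Helly_Selection"
    "HOL-Probability.Sinc_Integral"
begin

text \<open>
For fixed \<open>y\<close> the left-hand side depends on \<open>\<mu>\<close> only through its image \<open>\<nu>\<close> under
\<open>x \<mapsto> x \<bullet> y\<close>, a finite measure carried by the half-line. So the existence of \<open>\<xi>\<close> is a
statement about one-dimensional Stieltjes transforms (\<open>stieltjes_phase\<close>), a special case of
the exponential representation of Aronszajn and Donoghue.

Suppose first that \<open>\<nu>\<close> has finitely many atoms \<open>s\<close> with masses \<open>m s > 0\<close>. Then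
\<open>1 + (\<Sum>s. m s / (s - z))\<close> is a rational function whose zeros \<open>r s\<close> are real and strictly interlace the
poles (\<open>secular_roots\<close>), hence it equals \<open>\<Prod>s. (r s - z) / (s - z)\<close>. Each factor is the
exponential of the integral of \<open>1 / (t - z)\<close> over the interval \<open>{s..r s}\<close>, and these
intervals are disjoint: \<open>\<xi>\<close> is the indicator function of their union
(\<open>discrete_phase\<close>). Logarithmic differentiation at infinity expresses the moments of \<open>\<xi>\<close>
through those of \<open>\<nu>\<close> by a recursion (\<open>moment_recursion\<close>), so bounds on the latter give bounds
on the former; the total mass of \<open>\<xi>\<close> equals that of \<open>\<nu>\<close>.

A general \<open>\<nu>\<close> is approximated by the images of simple functions that increase to the identity.
The distribution functions \<open>u \<mapsto> \<integral>\<^bsub>t \<le> u\<^esub> \<xi> t\<close> of the phases are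
increasing, uniformly bounded and 1-Lipschitz. Helly's theorem gives a limit with the same
properties, and such a limit is the integral of a density with values in \<open>[0, 1]\<close>
(\<open>phase_compactness\<close>). Since \<open>1 / (t - z)\<close> is the integral of \<open>1 / (u - z)\<^sup>2\<close> over \<open>u \<ge> t\<close>,
Fubini's theorem turns pointwise convergence of the distribution functions into convergence of
the exponents (\<open>weak_convergence_from_cdf\<close>). Polynomially truncated monomials can be tested in
the same way, and this carries the moment bounds over to the limit (\<open>moment_of_weak_limit\<close>).

Measurability in \<open>y\<close> does not depend on how the phases are chosen. The bounds
\<open>0 \<le> \<xi> \<le> 1\<close> place the imaginary part of the exponent in \<open>[0, \<pi>]\<close>, so that it equals the imaginary
part of the principal logarithm of the left-hand side. It is also \<open>\<pi>\<close> times the Poisson integral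
of \<open>\<xi>\<close>. Integrating it along a line that approaches the real axis recovers the distribution
function of \<open>\<xi>\<close> (\<open>stieltjes_inversion\<close>), which is therefore a limit of functions that are
measurable in \<open>y\<close>. A monotone class argument extends this from half-lines to bounded
measurable test functions (\<open>measurable_integral_from_cdf\<close>).
\<close>

section \<open>Zeros of secular functions\<close>

lemma root_strictly_between:
  fixes f :: "real \<Rightarrow> real"
  assumes "a < b" "continuous_on {a..b} f" "f a * f b < 0"
  obtains c where "a < c" "c < b" "f c = 0"
proof -
  have ne: "f a \<noteq> 0" "f b \<noteq> 0" using assms(3) by auto
  have "\<exists>c. a \<le> c \<and> c \<le> b \<and> f c = 0"
  proof (cases "f a < 0")
    case True
    then have "f b > 0" using assms(3) by (simp add: mult_less_0_iff)
    then show ?thesis using IVT'[of f a 0 b] True assms by auto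
  next
    case False
    then have "f a > 0" "f b < 0" using ne assms(3) by (auto simp: mult_less_0_iff)
    then show ?thesis using IVT2'[of f b 0 a] assms by auto
  qed
  then show ?thesis using that ne by (metis less_le)
qed

text \<open>
The polynomial \<open>Q\<close> is the numerator of \<open>1 - (\<Sum>s. m s / (t - s))\<close>. At a pole \<open>s\<close> only one term
of \<open>Q\<close> survives. Its sign is determined by the number of larger poles, so \<open>Q\<close> changes sign
between neighbouring poles. After the largest pole \<open>Q\<close> starts negative and ends positive.
\<close>

lemma secular_roots:
  fixes A :: "real set" and m :: "real \<Rightarrow> real"
  defines "Q \<equiv> \<lambda>t. (\<Prod>s\<in>A. t - s) - (\<Sum>s\<in>A. m s * (\<Prod>s'\<in>A - {s}. t - s'))"
  assumes A: "finite A" and m: "\<forall>s\<in>A. 0 < m s"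
  shows "\<exists>r. (\<forall>s\<in>A. s < r s) \<and> (\<forall>s\<in>A. \<forall>s'\<in>A. s < s' \<longrightarrow> r s < s') \<and> (\<forall>s\<in>A. Q (r s) = 0)"
proof -
  have cont: "continuous_on X Q" for X
    unfolding Q_def by (intro continuous_intros)
  have Qs: "Q s = - m s * (\<Prod>s'\<in>A - {s}. s - s')" if s: "s \<in> A" for s
  proof -
    have "(\<Prod>s'\<in>A. s - s') = 0" using A s by (auto intro: prod_zero)
    moreover have "(\<Sum>a\<in>A. m a * (\<Prod>s'\<in>A - {a}. s - s')) = m s * (\<Prod>s'\<in>A - {s}. s - s')"
    proof (subst sum.remove[OF A s])
      have "(\<Prod>s'\<in>A - {a}. s - s') = 0" if "a \<in> A - {s}" for a
        using A s that by (intro prod_zero) auto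
      then show "m s * (\<Prod>s'\<in>A - {s}. s - s') + (\<Sum>a\<in>A - {s}. m a * (\<Prod>s'\<in>A - {a}. s - s')) =
         m s * (\<Prod>s'\<in>A - {s}. s - s')" by simp
    qed
    ultimately show ?thesis by (simp add: Q_def)
  qed
  have "\<exists>r. s < r \<and> (\<forall>s'\<in>A. s < s' \<longrightarrow> r < s') \<and> Q r = 0" if s: "s \<in> A" for s
  proof (cases "\<exists>s'\<in>A. s < s'")
    case True
    define B where "B = {s'\<in>A. s < s'}"
    have B: "finite B" "B \<noteq> {}" using A True by (auto simp: B_def)
    define u where "u = Min B"
    have u: "u \<in> A" "s < u" using Min_in[OF B] by (auto simp: u_def B_def)
    have umin: "u \<le> s'" if "s' \<in> A" "s < s'" for s'
      using that B by (auto simp: u_def B_def)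
    define C where "C = A - {s,u}"
    have "finite C" using A by (simp add: C_def)
    have 1: "(\<Prod>s'\<in>A - {s}. s - s') = (s - u) * (\<Prod>s'\<in>C. s - s')"
      using A u by (subst prod.remove[of "A - {s}" u]) (auto simp: C_def set_diff_eq intro!: prod.cong)
    have 2: "(\<Prod>s'\<in>A - {u}. u - s') = (u - s) * (\<Prod>s'\<in>C. u - s')"
      using A u s by (subst prod.remove[of "A - {u}" s]) (auto simp: C_def set_diff_eq intro!: prod.cong)
    have pos: "0 < (\<Prod>s'\<in>C. (s - s') * (u - s'))"
    proof (intro prod_pos)
      fix c assume c: "c \<in> C"
      then have "c < s \<or> u < c" using umin[of c] by (force simp: C_def)
      then show "0 < (s - c) * (u - c)" using u
        by (auto intro: mult_pos_pos mult_neg_neg)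
    qed
    have "Q s * Q u = (m s * m u * (u - s)) * (s - u) * (\<Prod>s'\<in>C. (s - s') * (u - s'))"
      by (simp add: Qs s u 1 2 prod.distrib)
    also have "\<dots> < 0"
      using bspec[OF m s] bspec[OF m u(1)] u pos by (intro mult_neg_pos mult_pos_neg mult_pos_pos) auto
    finally have "Q s * Q u < 0" .
    from root_strictly_between[OF u(2) cont this] obtain c where "s < c" "c < u" "Q c = 0" .
    then show ?thesis using umin by force
  next
    case False
    \<comment> \<open>At \<open>T\<close> every pole is farther away than the total mass, so the sum of all \<open>m a / (T - a)\<close> is below one.\<close>
    define T where "T = s + (\<Sum>a\<in>A. m a) + 1"
    have le: "a \<le> s" if "a \<in> A" for a using False that by force
    have S0: "0 \<le> (\<Sum>a\<in>A. m a)" using m by (intro sum_nonneg) (auto intro: less_imp_le)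
    have dist: "(\<Sum>a\<in>A. m a) + 1 \<le> T - a" if "a \<in> A" for a
      using le[OF that] by (simp add: T_def)
    have Tpos: "0 < T - a" if "a \<in> A" for a using dist[OF that] S0 by linarith
    have "Q T = (\<Prod>a\<in>A. T - a) * (1 - (\<Sum>a\<in>A. m a / (T - a)))"
    proof -
      have "m a * (\<Prod>s'\<in>A - {a}. T - s') = (\<Prod>s'\<in>A. T - s') * (m a / (T - a))" if "a \<in> A" for a
        using Tpos[OF that] by (subst prod.remove[OF A that]) auto
      then show ?thesis by (simp add: Q_def sum_distrib_left algebra_simps)
    qed
    moreover have "(\<Sum>a\<in>A. m a / (T - a)) < 1"
    proof -
      have "(\<Sum>a\<in>A. m a / (T - a)) \<le> (\<Sum>a\<in>A. m a / ((\<Sum>a\<in>A. m a) + 1))"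
        using m Tpos dist S0 by (intro sum_mono divide_left_mono mult_pos_pos) (auto intro: less_imp_le add_nonneg_pos)
      also have "\<dots> < 1" using S0 by (simp add: sum_divide_distrib[symmetric] divide_simps)
      finally show ?thesis .
    qed
    moreover have "0 < (\<Prod>a\<in>A. T - a)" using Tpos by (intro prod_pos) auto
    ultimately have QT: "0 < Q T" by simp
    have "0 < (\<Prod>s'\<in>A - {s}. s - s')" using le by (intro prod_pos) (auto simp: less_le)
    then have "Q s < 0" using Qs[OF s] bspec[OF m s] by simp
    then have "Q s * Q T < 0" using QT by (simp add: mult_neg_pos)
    moreover have "s < T" using S0 by (simp add: T_def)
    ultimately obtain c where "s < c" "c < T" "Q c = 0"
      using root_strictly_between[of s T Q] cont by blast
    then show ?thesis using False by auto
  qed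
  then have "\<forall>s\<in>A. \<exists>r. s < r \<and> (\<forall>s'\<in>A. s < s' \<longrightarrow> r < s') \<and> Q r = 0" by blast
  from bchoice[OF this] show ?thesis by blast
qed

text \<open>
Both sides are polynomials in \<open>z\<close> of degree at most \<open>card A\<close> with leading coefficient one, and
they agree at the \<open>card A\<close> distinct zeros found above.
\<close>

lemma secular_factorization:
  fixes A :: "real set" and m :: "real \<Rightarrow> real"
  assumes A: "finite A" and m: "\<forall>s\<in>A. 0 < m s"
  obtains r where "\<And>s. s \<in> A \<Longrightarrow> s < r s" "\<And>s s'. s \<in> A \<Longrightarrow> s' \<in> A \<Longrightarrow> s < s' \<Longrightarrow> r s < s'"
    "\<And>z::complex. (\<Prod>s\<in>A. z - of_real (r s)) =
       (\<Prod>s\<in>A. z - of_real s) - (\<Sum>s\<in>A. of_real (m s) * (\<Prod>s'\<in>A - {s}. z - of_real s'))"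
proof -
  obtain r where r: "\<And>s. s \<in> A \<Longrightarrow> s < r s" "\<And>s s'. s \<in> A \<Longrightarrow> s' \<in> A \<Longrightarrow> s < s' \<Longrightarrow> r s < s'"
    "\<And>s. s \<in> A \<Longrightarrow> (\<Prod>a\<in>A. r s - a) - (\<Sum>a\<in>A. m a * (\<Prod>s'\<in>A - {a}. r s - s')) = 0"
    using secular_roots[OF A m] by blast
  have inj: "inj_on r A"
  proof (rule inj_onI)
    fix x y assume "x \<in> A" "y \<in> A" "r x = r y"
    then show "x = y" using r(1)[of x] r(1)[of y] r(2)[of x y] r(2)[of y x] by (metis less_asym linorder_neqE)
  qed
  define P :: "complex poly" where "P = (\<Prod>s\<in>A. [:- of_real (r s), 1:])"
  define P0 :: "complex poly" where "P0 = (\<Prod>s\<in>A. [:- of_real s, 1:])"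
  define P1 :: "complex poly" where
    "P1 = (\<Sum>s\<in>A. smult (of_real (m s)) (\<Prod>s'\<in>A - {s}. [:- of_real s', 1:]))"
  have deg: "degree (\<Prod>s\<in>B. [:- f s, 1:]) = card B" for B and f :: "real \<Rightarrow> complex"
    by (subst degree_prod_eq_sum_degree) auto
  have lead: "poly.coeff (\<Prod>s\<in>B. [:- f s, 1:]) (card B) = 1" for B and f :: "real \<Rightarrow> complex"
    using lead_coeff_prod[of "\<lambda>s. [:- f s, 1:]" B] deg[of f B] by simp
  have cardless: "card (A - {s}) < card A" if "s \<in> A" for s
    using A that by (meson card_Diff1_less)
  have "poly.coeff P1 (card A) = 0"
    unfolding P1_def coeff_sum using cardless
    by (intro sum.neutral) (auto simp: deg intro!: coeff_eq_0)
  moreover have "degree P1 \<le> card A"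
    unfolding P1_def using cardless
    by (intro degree_sum_le A order.trans[OF degree_smult_le]) (auto simp: deg intro: less_imp_le)
  moreover have "card ((\<lambda>s. complex_of_real (r s)) ` A) = card A"
    using inj by (intro card_image) (auto simp: inj_on_def)
  moreover have "poly P z = poly (P0 - P1) z" if z: "z \<in> (\<lambda>s. complex_of_real (r s)) ` A" for z
  proof -
    obtain s where s: "s \<in> A" "z = of_real (r s)" using z by blast
    have "poly P z = 0" using s A by (simp add: P_def poly_prod) (auto intro: prod_zero)
    moreover have "poly (P0 - P1) z = of_real ((\<Prod>a\<in>A. r s - a) - (\<Sum>a\<in>A. m a * (\<Prod>s'\<in>A - {a}. r s - s')))"
      by (simp add: P0_def P1_def poly_prod poly_sum s)
    ultimately show ?thesis using r(3)[OF s(1)] by simp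
  qed
  ultimately have "P = P0 - P1"
    by (intro poly_eqI_degree_lead_coeff[where n="card A" and A="(\<lambda>s. complex_of_real (r s)) ` A"])
       (auto simp: P_def P0_def deg lead intro!: degree_diff_le)
  then have "poly P z = poly P0 z - poly P1 z" for z by simp
  then have "(\<Prod>s\<in>A. z - of_real (r s)) =
       (\<Prod>s\<in>A. z - of_real s) - (\<Sum>s\<in>A. of_real (m s) * (\<Prod>s'\<in>A - {s}. z - of_real s'))" for z :: complex
    by (simp add: P_def P0_def P1_def poly_prod poly_sum)
  then show ?thesis using r by (intro that[of r]) auto
qed

lemma secular_quotient:
  fixes A :: "real set" and m :: "real \<Rightarrow> real" and z :: complex
  assumes A: "finite A" and z: "z \<notin> of_real ` A"
    and eq: "(\<Prod>s\<in>A. z - of_real (r s)) =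
       (\<Prod>s\<in>A. z - of_real s) - (\<Sum>s\<in>A. of_real (m s) * (\<Prod>s'\<in>A - {s}. z - of_real s'))"
  shows "1 + (\<Sum>s\<in>A. of_real (m s) / (of_real s - z)) = (\<Prod>s\<in>A. (of_real (r s) - z) / (of_real s - z))"
proof -
  have ne: "z - of_real s \<noteq> 0" if "s \<in> A" for s using z that by auto
  then have P: "(\<Prod>s\<in>A. z - of_real s) \<noteq> 0" using A by simp
  have "(\<Prod>s\<in>A. (of_real (r s) - z) / (of_real s - z)) = (\<Prod>s\<in>A. (z - of_real (r s)) / (z - of_real s))"
    by (intro prod.cong) (metis minus_diff_eq minus_divide_divide)+
  also have "\<dots> = (\<Prod>s\<in>A. z - of_real (r s)) / (\<Prod>s\<in>A. z - of_real s)"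
    by (simp add: prod_dividef)
  also have "\<dots> = 1 - (\<Sum>s\<in>A. of_real (m s) * (\<Prod>s'\<in>A - {s}. z - of_real s') / (\<Prod>s\<in>A. z - of_real s))"
    using P by (simp add: eq diff_divide_distrib sum_divide_distrib)
  also have "(\<Sum>s\<in>A. of_real (m s) * (\<Prod>s'\<in>A - {s}. z - of_real s') / (\<Prod>s\<in>A. z - of_real s))
    = (\<Sum>s\<in>A. - (of_real (m s) / (of_real s - z)))"
  proof (intro sum.cong refl)
    fix s assume s: "s \<in> A"
    have "(\<Prod>s'\<in>A - {s}. z - of_real s') \<noteq> 0" using ne A by simp
    then show "of_real (m s) * (\<Prod>s'\<in>A - {s}. z - of_real s') / (\<Prod>s\<in>A. z - of_real s) = - (of_real (m s) / (of_real s - z))"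
      using ne[OF s] by (subst prod.remove[OF A s]) (simp add: divide_simps algebra_simps)
  qed
  finally show ?thesis by (simp add: sum_negf)
qed

section \<open>Moments of interlacing zeros and poles\<close>

definition geometric_fps :: "real \<Rightarrow> real fps" where
  "geometric_fps c = Abs_fps (\<lambda>n. c ^ n)"

lemma one_minus_mult_geometric_fps: "(1 - fps_const c * fps_X) * geometric_fps c = 1"
proof (rule fps_ext)
  fix n show "fps_nth ((1 - fps_const c * fps_X) * geometric_fps c) n = fps_nth 1 n"
    by (cases n) (simp_all add: geometric_fps_def left_diff_distrib mult.assoc)
qed

lemma fps_deriv_prod_linear:
  assumes "finite A"
  shows "fps_deriv (\<Prod>s\<in>A. 1 - fps_const (c s) * fps_X) =
    - (\<Prod>s\<in>A. 1 - fps_const (c s) * fps_X) * (\<Sum>s\<in>A. fps_const (c s) * geometric_fps (c s))"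
  using assms
proof induction
  case (insert a A)
  define P where "P = (\<Prod>s\<in>A. 1 - fps_const (c s) * fps_X)"
  define Z where "Z = (\<Sum>s\<in>A. fps_const (c s) * geometric_fps (c s))"
  have IH: "fps_deriv P = - P * Z" using insert by (simp add: P_def Z_def)
  define L where "L = 1 - fps_const (c a) * fps_X"
  define g where "g = geometric_fps (c a)"
  have Lg: "L * g = 1" using one_minus_mult_geometric_fps by (simp add: L_def g_def)
  have "fps_deriv L = - fps_const (c a)" by (simp add: L_def)
  then have "fps_deriv (L * P) = - fps_const (c a) * P * (L * g) - L * P * Z"
    using IH Lg by (simp add: algebra_simps)
  also have "\<dots> = - (L * P) * (fps_const (c a) * g + Z)" by (simp add: algebra_simps flip: fps_const_neg)
  finally show ?case using insert by (simp add: P_def Z_def L_def g_def)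
qed simp

text \<open>
In the variable \<open>w = 1 / z\<close> the factorization says \<open>R = S * f\<close>, where \<open>R\<close> and \<open>S\<close> are
the products of \<open>1 - r s * w\<close> and of \<open>1 - s * w\<close>, and where \<open>f\<close> has the coefficients
\<open>1, - M 0, - M 1, \<dots>\<close>. The logarithmic derivative of \<open>R / S\<close> is the power series with
coefficients \<open>- D n\<close>. Comparing coefficients in \<open>f' = f * (R' / R - S' / S)\<close> gives the recursion.
It is the form that Newton's identities take for the quotient of two polynomials.
\<close>

lemma moment_recursion:
  fixes A :: "real set" and m r :: "real \<Rightarrow> real"
  defines "D \<equiv> \<lambda>n. \<Sum>s\<in>A. r s ^ Suc n - s ^ Suc n" and "M \<equiv> \<lambda>n. \<Sum>s\<in>A. m s * s ^ n"
  assumes A: "finite A"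
    and eq: "\<And>z::complex. (\<Prod>s\<in>A. z - of_real (r s)) =
       (\<Prod>s\<in>A. z - of_real s) - (\<Sum>s\<in>A. of_real (m s) * (\<Prod>s'\<in>A - {s}. z - of_real s'))"
  shows "D n = real (Suc n) * M n + (\<Sum>j<n. M j * D (n - Suc j))"
proof -
  have eqr: "(\<Prod>s\<in>A. x - r s) = (\<Prod>s\<in>A. x - s) - (\<Sum>s\<in>A. m s * (\<Prod>s'\<in>A - {s}. x - s'))" for x :: real
  proof -
    have "complex_of_real (\<Prod>s\<in>A. x - r s) = of_real ((\<Prod>s\<in>A. x - s) - (\<Sum>s\<in>A. m s * (\<Prod>s'\<in>A - {s}. x - s')))"
      using eq[of "of_real x"] by simp
    then show ?thesis by (simp only: of_real_eq_iff)
  qed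
  \<comment> \<open>The same identity for the reversed polynomials, by the substitution of \<open>1 / w\<close>.\<close>
  have eqw: "(\<Prod>s\<in>A. 1 - r s * w) = (\<Prod>s\<in>A. 1 - s * w) - w * (\<Sum>s\<in>A. m s * (\<Prod>s'\<in>A - {s}. 1 - s' * w))"
    if w: "w \<noteq> 0" for w :: real
  proof -
    have h: "(\<Prod>s\<in>B. 1 - c s * w) = w ^ card B * (\<Prod>s\<in>B. 1 / w - c s)" for B :: "real set" and c
    proof -
      have "(\<Prod>s\<in>B. 1 - c s * w) = (\<Prod>s\<in>B. w * (1 / w - c s))"
        using w by (intro prod.cong) (auto simp: field_simps)
      then show ?thesis by (simp add: prod.distrib)
    qed
    have c: "w ^ card A = w * w ^ card (A - {s})" if "s \<in> A" for s
      using card.remove[OF A that] by simp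
    have "w ^ card A * (\<Sum>s\<in>A. m s * (\<Prod>s'\<in>A - {s}. 1 / w - s'))
      = w * (\<Sum>s\<in>A. m s * (w ^ card (A - {s}) * (\<Prod>s'\<in>A - {s}. 1 / w - s')))"
      using c by (simp add: sum_distrib_left mult_ac cong: sum.cong)
    then show ?thesis
      using h[of r A] h[of "\<lambda>s. s" A] h[of "\<lambda>s. s" "A - {s}" for s] eqr[of "1 / w"]
      by (simp add: right_diff_distrib)
  qed
  define R where "R = (\<Prod>s\<in>A. 1 - fps_const (r s) * fps_X)"
  define S where "S = (\<Prod>s\<in>A. 1 - fps_const s * fps_X)"
  define f where "f = 1 - fps_X * (\<Sum>s\<in>A. fps_const (m s) * geometric_fps s)"
  have "(\<Prod>s\<in>A. [:1, - r s:]) = (\<Prod>s\<in>A. [:1, - s:]) - [:0,1:] * (\<Sum>s\<in>A. [:m s:] * (\<Prod>s'\<in>A - {s}. [:1, - s':]))"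
    (is "?p = ?q")
  proof (rule ccontr)
    assume "?p \<noteq> ?q"
    then have "finite {x. poly (?p - ?q) x = 0}" by (intro poly_roots_finite) auto
    moreover have "- {0} \<subseteq> {x. poly (?p - ?q) x = 0}"
      using eqw by (auto simp: poly_prod poly_sum mult.commute)
    ultimately have "finite (- {0::real})" using finite_subset by blast
    then show False by (simp add: finite_compl infinite_UNIV_char_0)
  qed
  then have "fps_of_poly ?p = fps_of_poly ?q" by simp
  then have "R = S - fps_X * (\<Sum>s\<in>A. fps_const (m s) * (\<Prod>s'\<in>A - {s}. 1 - fps_const s' * fps_X))"
    by (simp add: R_def S_def fps_of_poly_prod fps_of_poly_sum fps_of_poly_mult fps_of_poly_smult fps_of_poly_diff fps_of_poly_pCons mult.commute
        flip: fps_const_neg)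
  moreover have "(\<Prod>s'\<in>A - {s}. 1 - fps_const s' * fps_X) = S * geometric_fps s" if "s \<in> A" for s
    using one_minus_mult_geometric_fps[of s] by (simp add: S_def prod.remove[OF A that] mult_ac)
  ultimately have RS: "R = S * f"
    by (simp add: f_def right_diff_distrib sum_distrib_left mult_ac cong: sum.cong)
  define E where "E = (\<Sum>s\<in>A. fps_const (r s) * geometric_fps (r s)) - (\<Sum>s\<in>A. fps_const s * geometric_fps s)"
  have "S \<noteq> 0"
  proof -
    have "fps_nth S 0 = 1" using A unfolding S_def by induction (auto simp: fps_mult_nth_0)
    then show ?thesis by auto
  qed
  have "S * fps_deriv f = S * (- f * E)"
    using arg_cong[OF RS, of fps_deriv] fps_deriv_prod_linear[OF A, of r] fps_deriv_prod_linear[OF A, of "\<lambda>s. s"]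
    by (simp add: E_def RS flip: R_def S_def) (simp add: algebra_simps)
  then have f': "fps_deriv f = - f * E" using mult_left_cancel[OF \<open>S \<noteq> 0\<close>] by blast
  have En: "fps_nth E k = D k" for k
    by (simp add: E_def D_def fps_sum_nth geometric_fps_def sum_subtractf)
  have f0: "fps_nth f 0 = 1" by (simp add: f_def)
  have fS: "fps_nth f (Suc k) = - M k" for k
    by (simp add: f_def M_def fps_sum_nth geometric_fps_def)
  have "- (real (Suc n) * M n) = - (\<Sum>i=0..n. fps_nth f i * D (n - i))"
    using arg_cong[OF f', of "\<lambda>g. fps_nth g n"] by (simp add: fS fps_mult_nth En sum_negf)
  also have "(\<Sum>i=0..n. fps_nth f i * D (n - i)) = D n - (\<Sum>j<n. M j * D (n - Suc j))"
  proof -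
    have "(\<Sum>i=0..n. fps_nth f i * D (n - i)) = (\<Sum>i<Suc n. fps_nth f i * D (n - i))"
      by (simp only: lessThan_Suc_atMost atLeast0AtMost)
    then show ?thesis unfolding sum.lessThan_Suc_shift by (simp add: f0 fS sum_negf)
  qed
  finally show ?thesis by simp
qed

text \<open>
All terms of the recursion are nonnegative, so a bound on \<open>M 0, \<dots>, M n\<close> bounds \<open>D n\<close>. The bound \<open>K\<close> is
chosen before the sequences; this uniformity is what survives the passage to a limit.
\<close>

lemma moment_bound:
  "\<exists>K. \<forall>D M. (\<forall>k. D k = real (Suc k) * M k + (\<Sum>j<k. M j * D (k - Suc j))) \<longrightarrow>
     (\<forall>k. 0 \<le> D k \<and> 0 \<le> M k) \<longrightarrow> (\<forall>k\<le>n. M k \<le> b) \<longrightarrow> D n \<le> K"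
proof (induction n rule: less_induct)
  case (less n)
  then have "\<forall>k. \<exists>K. k < n \<longrightarrow> (\<forall>D M. (\<forall>k. D k = real (Suc k) * M k + (\<Sum>j<k. M j * D (k - Suc j))) \<longrightarrow>
     (\<forall>k. 0 \<le> D k \<and> 0 \<le> M k) \<longrightarrow> (\<forall>j\<le>k. M j \<le> b) \<longrightarrow> D k \<le> K)"
    by blast
  from choice[OF this] obtain K where K: "\<And>k D M. \<lbrakk>k < n; \<forall>k. D k = real (Suc k) * M k + (\<Sum>j<k. M j * D (k - Suc j));
     \<forall>k. 0 \<le> D k \<and> 0 \<le> M k; \<forall>j\<le>k. M j \<le> b\<rbrakk> \<Longrightarrow> D k \<le> K k"
    by blast
  show ?case
  proof (intro exI allI impI)
    fix D M :: "nat \<Rightarrow> real"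
    assume r: "\<forall>k. D k = real (Suc k) * M k + (\<Sum>j<k. M j * D (k - Suc j))"
      and nn: "\<forall>k. 0 \<le> D k \<and> 0 \<le> M k" and b: "\<forall>k\<le>n. M k \<le> b"
    have "D n = real (Suc n) * M n + (\<Sum>j<n. M j * D (n - Suc j))" using r by blast
    also have "\<dots> \<le> real (Suc n) * b + (\<Sum>j<n. b * K (n - Suc j))"
    proof (intro add_mono mult_left_mono sum_mono mult_mono)
      fix j assume j: "j \<in> {..<n}"
      show "D (n - Suc j) \<le> K (n - Suc j)" using j b by (intro K[OF _ r nn]) auto
      show "0 \<le> b" using nn b order_trans by blast
    qed (use b nn in auto)
    finally show "D n \<le> real (Suc n) * b + (\<Sum>j<n. b * K (n - Suc j))" .
  qed
qed

section \<open>The Cauchy and Poisson kernels\<close>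

lemma of_real_minus_nonreal_neq_0:
  assumes "0 < Im z" shows "complex_of_real t - z \<noteq> 0" "complex_of_real t - z \<notin> \<real>\<^sub>\<le>\<^sub>0" "z \<noteq> complex_of_real t"
  using assms by (auto simp: complex_eq_iff complex_nonpos_Reals_iff)

lemma norm_cauchy_kernel_square:
  "(cmod (complex_of_real t - z))\<^sup>2 = (t - Re z)\<^sup>2 + (Im z)\<^sup>2"
  by (simp add: cmod_power2)

lemma Im_cauchy_kernel: "Im (1 / (complex_of_real t - z)) = Im z / ((t - Re z)\<^sup>2 + (Im z)\<^sup>2)"
  by (simp add: Im_divide)

lemma norm_cauchy_kernel_le:
  assumes "0 < Im z" shows "cmod (1 / (complex_of_real t - z)) \<le> 1 / Im z"
proof -
  have "Im z \<le> cmod (complex_of_real t - z)" using abs_Im_le_cmod[of "of_real t - z"] by simp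
  then show ?thesis using assms by (simp add: norm_divide frac_le)
qed

lemma poisson_kernel:
  fixes x y :: real
  assumes y: "0 < y"
  shows "integrable lborel (\<lambda>t. y / ((t - x)\<^sup>2 + y\<^sup>2))" "(LINT t|lborel. y / ((t - x)\<^sup>2 + y\<^sup>2)) = pi"
proof -
  have i: "integrable lborel (\<lambda>t::real. inverse (1 + t\<^sup>2))"
    using integrable_inverse_1_plus_square by (simp add: set_integrable_def)
  have v: "(LINT t|lborel. inverse (1 + t\<^sup>2)) = pi"
    using LBINT_inverse_1_plus_square by (simp add: interval_lebesgue_integral_def set_lebesgue_integral_def)
  have eq: "1 / y * inverse (1 + (- x / y + 1 / y * t)\<^sup>2) = y / ((t - x)\<^sup>2 + y\<^sup>2)" for t
  proof -
    have "(- x / y + 1 / y * t) = (t - x) / y" by (simp add: diff_divide_distrib)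
    moreover have "1 + ((t - x) / y)\<^sup>2 = ((t - x)\<^sup>2 + y\<^sup>2) / y\<^sup>2" using y by (simp add: power_divide field_simps)
    ultimately show ?thesis using y by (simp add: power2_eq_square)
  qed
  have "integrable lborel (\<lambda>t. 1 / y * inverse (1 + (- x / y + 1 / y * t)\<^sup>2))"
    using lborel_integrable_real_affine[OF i, of "1 / y" "- x / y"] y by (intro integrable_mult_right) simp
  then show "integrable lborel (\<lambda>t. y / ((t - x)\<^sup>2 + y\<^sup>2))" unfolding eq .
  have "pi = 1 / y * (LINT t|lborel. inverse (1 + (- x / y + 1 / y * t)\<^sup>2))"
    using lborel_integral_real_affine[of "1 / y" "\<lambda>t. inverse (1 + t\<^sup>2)" "- x / y"] y by (simp add: v)
  also have "\<dots> = (LINT t|lborel. y / ((t - x)\<^sup>2 + y\<^sup>2))"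
    unfolding eq[symmetric] by (rule integral_mult_right_zero[symmetric])
  finally show "(LINT t|lborel. y / ((t - x)\<^sup>2 + y\<^sup>2)) = pi" by simp
qed

text \<open>
Writing the Cauchy kernel as the tail integral of an integrable function makes it a test
function for convergence of distribution functions.
\<close>

lemma cauchy_kernel_tail:
  assumes z: "0 < Im z"
  shows "integrable lborel (\<lambda>u. 1 / (complex_of_real u - z)\<^sup>2)"
    "(LINT u:{t..}|lborel. 1 / (complex_of_real u - z)\<^sup>2) = 1 / (complex_of_real t - z)"
proof -
  note nz = of_real_minus_nonreal_neq_0[OF z]
  show int: "integrable lborel (\<lambda>u. 1 / (complex_of_real u - z)\<^sup>2)"
  proof (rule Bochner_Integration.integrable_bound)
    show "integrable lborel (\<lambda>u. 1 / Im z * (Im z / ((u - Re z)\<^sup>2 + (Im z)\<^sup>2)))"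
      by (intro integrable_mult_right poisson_kernel z)
    show "AE u in lborel. cmod (1 / (complex_of_real u - z)\<^sup>2) \<le> norm (1 / Im z * (Im z / ((u - Re z)\<^sup>2 + (Im z)\<^sup>2)))"
      using z by (auto simp: norm_divide norm_power norm_cauchy_kernel_square)
  qed simp
  have "(LINT u:{t..b}|lborel. 1 / (complex_of_real u - z)\<^sup>2) = 1 / (of_real t - z) - 1 / (of_real b - z)" if "t \<le> b" for b
  proof -
    have "((\<lambda>w. - 1 / (w - z)) has_field_derivative 1 / (of_real x - z)\<^sup>2) (at (of_real x))" for x :: real
      using nz(1)[of x] by (auto intro!: derivative_eq_intros simp: power2_eq_square)
    then have "((\<lambda>x. - 1 / (complex_of_real x - z)) has_vector_derivative 1 / (of_real x - z)\<^sup>2) (at x within {t..b})" for x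
      by (rule has_vector_derivative_real_field)
    then show ?thesis unfolding set_lebesgue_integral_def using nz that
      by (subst integral_FTC_atLeastAtMost[where F="\<lambda>x. - 1 / (complex_of_real x - z)"]) (auto intro!: continuous_intros)
  qed
  then have "\<forall>\<^sub>F b in at_top. (LINT u:{t..b}|lborel. 1 / (complex_of_real u - z)\<^sup>2) = 1 / (of_real t - z) - 1 / (of_real b - z)"
    by (rule eventually_mono[OF eventually_ge_at_top[of t]])
  moreover have "((\<lambda>b. 1 / (of_real t - z) - 1 / (complex_of_real b - z)) \<longlongrightarrow> 1 / (of_real t - z) - 0) at_top"
  proof (intro tendsto_diff tendsto_const)
    have "filterlim (\<lambda>b. complex_of_real b - z) at_infinity at_top"
      using tendsto_add_filterlim_at_infinity[OF tendsto_const[of "- z"] filterlim_of_real_at_infinity]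
      by simp
    then show "((\<lambda>b. 1 / (complex_of_real b - z)) \<longlongrightarrow> 0) at_top" by (rule tendsto_divide_0[OF tendsto_const])
  qed
  ultimately have "((\<lambda>b. LINT u:{t..b}|lborel. 1 / (complex_of_real u - z)\<^sup>2) \<longlongrightarrow> 1 / (of_real t - z)) at_top"
    by (simp add: filterlim_cong)
  moreover have "((\<lambda>b. LINT u:{t..b}|lborel. 1 / (complex_of_real u - z)\<^sup>2) \<longlongrightarrow> (LINT u:{t..}|lborel. 1 / (complex_of_real u - z)\<^sup>2)) at_top"
    using int by (intro tendsto_set_lebesgue_integral_at_top) (auto simp: set_integrable_def intro: integrable_mult_indicator)
  ultimately show "(LINT u:{t..}|lborel. 1 / (complex_of_real u - z)\<^sup>2) = 1 / (complex_of_real t - z)"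
    by (intro tendsto_unique[OF _ _]) auto
qed

section \<open>The phase of a measure with finitely many atoms\<close>

lemma integral_sum_indicators:
  fixes f :: "real \<Rightarrow> 'a::euclidean_space"
  assumes A: "finite A" and le: "\<And>s. s \<in> A \<Longrightarrow> s \<le> r s"
    and F: "\<And>x. (F has_vector_derivative f x) (at x)" and f: "continuous_on UNIV f"
  shows "integrable lborel (\<lambda>t. (\<Sum>s\<in>A. indicator {s..r s} t) *\<^sub>R f t)" (is ?i)
    "(LINT t|lborel. (\<Sum>s\<in>A. indicator {s..r s} t) *\<^sub>R f t) = (\<Sum>s\<in>A. F (r s) - F s)"
proof -
  have i: "integrable lborel (\<lambda>t. indicator {s..r s} t *\<^sub>R f t)" for s
    using borel_integrable_atLeastAtMost'[of s "r s" f] continuous_on_subset[OF f]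
    by (simp add: set_integrable_def)
  show ?i by (simp add: scaleR_sum_left i)
  have "(LINT t|lborel. (\<Sum>s\<in>A. indicator {s..r s} t) *\<^sub>R f t) = (\<Sum>s\<in>A. LINT t|lborel. indicator {s..r s} t *\<^sub>R f t)"
    by (simp add: scaleR_sum_left i)
  also have "\<dots> = (\<Sum>s\<in>A. F (r s) - F s)"
    using le F f by (intro sum.cong refl integral_FTC_atLeastAtMost)
      (auto intro: has_vector_derivative_at_within continuous_on_subset)
  finally show "(LINT t|lborel. (\<Sum>s\<in>A. indicator {s..r s} t) *\<^sub>R f t) = (\<Sum>s\<in>A. F (r s) - F s)" .
qed

text \<open>
The phase is the indicator function of the union of the intervals from each pole to the zero that follows it.
It never exceeds one because interlacing makes these intervals disjoint. Its \<open>n\<close>-th moment is the sum of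
\<open>(r s ^ (n + 1) - s ^ (n + 1)) / (n + 1)\<close>, which explains the sequence \<open>D\<close>.
\<close>

lemma discrete_phase:
  fixes A :: "real set" and m :: "real \<Rightarrow> real"
  assumes A: "finite A" and A0: "\<And>s. s \<in> A \<Longrightarrow> 0 \<le> s" and m: "\<forall>s\<in>A. 0 < m s"
  obtains \<xi> D where
    "\<xi> \<in> borel_measurable borel" "\<And>t. 0 \<le> \<xi> t" "\<And>t. \<xi> t \<le> 1" "\<And>t. t < 0 \<Longrightarrow> \<xi> t = 0"
    "\<And>z. 0 < Im z \<Longrightarrow> 1 + (\<Sum>s\<in>A. of_real (m s) / (of_real s - z)) = exp (LINT t|lborel. \<xi> t *\<^sub>R (1 / (complex_of_real t - z)))"
    "\<And>n. integrable lborel (\<lambda>t. t ^ n * \<xi> t)" "\<And>n. (LINT t|lborel. t ^ n * \<xi> t) = D n / real (Suc n)"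
    "\<And>n. D n = real (Suc n) * (\<Sum>s\<in>A. m s * s ^ n) + (\<Sum>j<n. (\<Sum>s\<in>A. m s * s ^ j) * D (n - Suc j))"
    "\<And>n. 0 \<le> D n"
proof -
  obtain r where r: "\<And>s. s \<in> A \<Longrightarrow> s < r s" "\<And>s s'. s \<in> A \<Longrightarrow> s' \<in> A \<Longrightarrow> s < s' \<Longrightarrow> r s < s'"
    "\<And>z::complex. (\<Prod>s\<in>A. z - of_real (r s)) =
       (\<Prod>s\<in>A. z - of_real s) - (\<Sum>s\<in>A. of_real (m s) * (\<Prod>s'\<in>A - {s}. z - of_real s'))"
    using secular_factorization[OF A m] by blast
  have rle: "s \<le> r s" if "s \<in> A" for s using r(1)[OF that] by simp
  define \<xi> :: "real \<Rightarrow> real" where "\<xi> t = (\<Sum>s\<in>A. indicator {s..r s} t)" for t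
  define D where "D n = (\<Sum>s\<in>A. r s ^ Suc n - s ^ Suc n)" for n
  show ?thesis
  proof (rule that[of \<xi> D])
    show "\<xi> \<in> borel_measurable borel" unfolding \<xi>_def by measurable
    show "0 \<le> \<xi> t" for t unfolding \<xi>_def by (intro sum_nonneg) auto
    show "\<xi> t \<le> 1" for t
    proof (cases "\<exists>s\<in>A. t \<in> {s..r s}")
      case True
      then obtain s where s: "s \<in> A" "t \<in> {s..r s}" by blast
      have "indicator {a..r a} t = (0::real)" if "a \<in> A - {s}" for a
        using s that r(2)[of a s] r(2)[of s a] by (cases "a < s") (auto simp: indicator_def)
      then show ?thesis unfolding \<xi>_def using s by (simp add: sum.remove[OF A s(1)])
    next
      case False
      then show ?thesis unfolding \<xi>_def by (subst sum.neutral) (auto simp: indicator_def)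
    qed
    show "\<xi> t = 0" if "t < 0" for t
      unfolding \<xi>_def using A0 that by (intro sum.neutral) (force simp: indicator_def)
    show "1 + (\<Sum>s\<in>A. of_real (m s) / (of_real s - z)) = exp (LINT t|lborel. \<xi> t *\<^sub>R (1 / (complex_of_real t - z)))"
      if z: "0 < Im z" for z
    proof -
      note nz = of_real_minus_nonreal_neq_0[OF z]
      have "((\<lambda>w. Ln (w - z)) has_field_derivative 1 / (of_real x - z)) (at (of_real x))" for x :: real
        using nz[of x] by (auto intro!: derivative_eq_intros simp: field_simps)
      then have "((\<lambda>x. Ln (complex_of_real x - z)) has_vector_derivative 1 / (of_real x - z)) (at x)" for x
        by (rule has_vector_derivative_real_field)
      then have "(LINT t|lborel. \<xi> t *\<^sub>R (1 / (complex_of_real t - z))) = (\<Sum>s\<in>A. Ln (of_real (r s) - z) - Ln (of_real s - z))"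
        unfolding \<xi>_def using nz by (intro integral_sum_indicators A rle) (auto intro!: continuous_intros)
      then have "exp (LINT t|lborel. \<xi> t *\<^sub>R (1 / (complex_of_real t - z))) = (\<Prod>s\<in>A. (of_real (r s) - z) / (of_real s - z))"
        using A nz by (simp add: exp_sum exp_diff)
      moreover have "z \<notin> of_real ` A" using nz by blast
      ultimately show ?thesis using secular_quotient[OF A _ r(3)] by metis
    qed
    have pw: "((\<lambda>x. x ^ Suc n / real (Suc n)) has_vector_derivative x ^ n) (at x)" for n and x :: real
      unfolding has_real_derivative_iff_has_vector_derivative[symmetric]
      using DERIV_cdivide[OF DERIV_pow[of "Suc n" x], of "real (Suc n)"] by (simp del: of_nat_Suc)
    show "integrable lborel (\<lambda>t. t ^ n * \<xi> t)" for n
      using integral_sum_indicators(1)[OF A rle pw] unfolding \<xi>_def by (simp add: continuous_intros mult.commute)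
    show "(LINT t|lborel. t ^ n * \<xi> t) = D n / real (Suc n)" for n
      using integral_sum_indicators(2)[OF A rle pw] unfolding \<xi>_def D_def
      by (simp add: continuous_intros mult.commute sum_divide_distrib diff_divide_distrib del: of_nat_Suc)
    show "D n = real (Suc n) * (\<Sum>s\<in>A. m s * s ^ n) + (\<Sum>j<n. (\<Sum>s\<in>A. m s * s ^ j) * D (n - Suc j))" for n
      unfolding D_def by (rule moment_recursion[OF A r(3)])
    show "0 \<le> D n" for n unfolding D_def using rle A0
      by (intro sum_nonneg) (auto intro: power_mono simp del: power_Suc)
  qed
qed

section \<open>Weak compactness of phases\<close>

lemma continuous_within_if_nonexpansive:
  fixes f :: "real \<Rightarrow> real"
  assumes "\<And>a b. \<bar>f b - f a\<bar> \<le> \<bar>b - a\<bar>"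
  shows "continuous (at x within S) f"
  unfolding continuous_within_eps_delta dist_real_def using assms by (metis le_less_trans)

text \<open>
Both \<open>F\<close> and \<open>t \<mapsto> t - F t\<close> are increasing and continuous, and their Stieltjes measures add
up to Lebesgue measure. Hence both measures are absolutely continuous, and their
Radon-Nikodym densities add up to one almost everywhere.
\<close>

lemma lipschitz_mono_density:
  fixes F :: "real \<Rightarrow> real"
  assumes mono: "mono F" and lip: "\<And>a b. a \<le> b \<Longrightarrow> F b - F a \<le> b - a"
  obtains \<eta> where "\<eta> \<in> borel_measurable borel" "\<And>t. 0 \<le> \<eta> t" "\<And>t. \<eta> t \<le> 1"
    "\<And>a b. a \<le> b \<Longrightarrow> (LINT t:{a<..b}|lborel. \<eta> t) = F b - F a"
proof -
  define \<kappa> where "\<kappa> = interval_measure F"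
  define \<kappa>' where "\<kappa>' = interval_measure (\<lambda>t. t - F t)"
  have lips: "\<bar>F b - F a\<bar> \<le> \<bar>b - a\<bar>" for a b
    using lip[of a b] lip[of b a] monoD[OF mono, of a b] monoD[OF mono, of b a] by linarith
  have lips': "\<bar>(b - F b) - (a - F a)\<bar> \<le> \<bar>b - a\<bar>" for a b
    using lip[of a b] lip[of b a] monoD[OF mono, of a b] monoD[OF mono, of b a] by linarith
  note rc = continuous_within_if_nonexpansive[of F, OF lips]
    continuous_within_if_nonexpansive[of "\<lambda>t. t - F t", OF lips']
  have cont: "continuous_on UNIV F" "continuous_on UNIV (\<lambda>t. t - F t)"
    by (auto simp: continuous_on_eq_continuous_within rc)
  have m: "a \<le> b \<Longrightarrow> F a \<le> F b" "a \<le> b \<Longrightarrow> a - F a \<le> b - F b" for a b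
    using monoD[OF mono] lip[of a b] by auto
  have s[measurable_cong, simp]: "sets \<kappa> = sets borel" "sets \<kappa>' = sets borel" by (simp_all add: \<kappa>_def \<kappa>'_def)
  have ioc: "emeasure \<kappa> {a<..b} = ennreal (F b - F a)" if "a \<le> b" for a b
    unfolding \<kappa>_def by (rule emeasure_interval_measure_Ioc[OF that m(1) rc(1)])
  have icc: "emeasure \<kappa> {a..b} = ennreal (F b - F a)" "emeasure \<kappa>' {a..b} = ennreal ((b - F b) - (a - F a))" if "a \<le> b" for a b
    unfolding \<kappa>_def \<kappa>'_def using emeasure_interval_measure_Icc[OF that m(1) cont(1)] emeasure_interval_measure_Icc[OF that m(2) cont(2)]
    by auto
  have box: "emeasure M (box l u) = emeasure M {l..u}" if M: "l \<le> u" "\<And>x. emeasure M {x..x} = 0" "sets M = sets borel"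
    for l u :: real and M
  proof (rule emeasure_eq_AE)
    have "{l} \<union> {u} \<in> null_sets M" using M(2)[of l] M(2)[of u] M(3)
      by (intro null_sets.Un) (auto simp: null_sets_def)
    then show "AE x in M. (x \<in> box l u) = (x \<in> {l..u})"
      by (rule AE_I') auto
  qed (use M in auto)
  define N where "N = measure_of UNIV (sets borel) (\<lambda>A. emeasure \<kappa> A + emeasure \<kappa>' A)"
  have sN: "sets N = sets borel" by (simp add: N_def sigma_algebra.sets_measure_of_eq[OF sets.sigma_algebra_axioms[of borel, simplified]] flip: space_borel)
  have N: "emeasure N A = emeasure \<kappa> A + emeasure \<kappa>' A" if "A \<in> sets borel" for A
  proof (rule emeasure_measure_of[OF N_def])
    show "countably_additive (sets N) (\<lambda>A. emeasure \<kappa> A + emeasure \<kappa>' A)"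
    proof (rule countably_additiveI)
      fix B :: "nat \<Rightarrow> real set"
      assume B: "range B \<subseteq> sets N" "disjoint_family B" "(\<Union>i. B i) \<in> sets N"
      then have "range B \<subseteq> sets \<kappa>" "range B \<subseteq> sets \<kappa>'" unfolding s sN by blast+
      from suminf_emeasure[OF this(1) B(2)] suminf_emeasure[OF this(2) B(2)]
      show "(\<Sum>i. emeasure \<kappa> (B i) + emeasure \<kappa>' (B i)) = emeasure \<kappa> (\<Union>i. B i) + emeasure \<kappa>' (\<Union>i. B i)"
        by (subst suminf_add[symmetric]) (auto intro: summableI)
    qed
  qed (use that sN in \<open>auto simp: positive_def\<close>)
  have "lborel = N"
  proof (rule lborel_eqI[OF _ sN])
    fix l u :: real
    assume "\<And>b. b \<in> Basis \<Longrightarrow> l \<bullet> b \<le> u \<bullet> b"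
    then have lu: "l \<le> u" by simp
    have "emeasure \<kappa> (box l u) = emeasure \<kappa> {l..u}" "emeasure \<kappa>' (box l u) = emeasure \<kappa>' {l..u}"
      using icc[of x x for x] by (intro box lu; simp)+
    then have "emeasure N (box l u) = emeasure \<kappa> {l..u} + emeasure \<kappa>' {l..u}"
      using N[of "box l u"] by simp
    also have "\<dots> = ennreal (u - l)"
      using m[OF lu] by (simp add: icc lu flip: ennreal_plus)
    finally show "emeasure N (box l u) = (\<Prod>b\<in>Basis. (u - l) \<bullet> b)" by simp
  qed
  then have L: "emeasure lborel A = emeasure \<kappa> A + emeasure \<kappa>' A" if "A \<in> sets borel" for A
    using N[OF that] by simp
  have "absolutely_continuous lborel \<kappa>" "absolutely_continuous lborel \<kappa>'"
    by (auto simp: absolutely_continuous_def null_sets_def L)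
  then obtain f f' where f[measurable]: "f \<in> borel_measurable lborel" "f' \<in> borel_measurable lborel"
    and df: "density lborel f = \<kappa>" "density lborel f' = \<kappa>'"
    using sigma_finite_measure.Radon_Nikodym[OF sigma_finite_lborel] by (metis s sets_lborel)
  have "density lborel (\<lambda>t. f t + f' t) = density lborel (\<lambda>_. 1)"
  proof (rule measure_eqI)
    fix A assume "A \<in> sets (density lborel (\<lambda>t. f t + f' t))"
    then have A[measurable]: "A \<in> sets borel" by simp
    have "emeasure (density lborel (\<lambda>t. f t + f' t)) A = emeasure (density lborel f) A + emeasure (density lborel f') A"
      by (simp add: emeasure_density distrib_right nn_integral_add)
    then show "emeasure (density lborel (\<lambda>t. f t + f' t)) A = emeasure (density lborel (\<lambda>_. 1)) A"
      by (simp add: df L density_1)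
  qed simp
  then have "AE t in lborel. f t + f' t = 1"
    by (intro sigma_finite_measure.density_unique[OF sigma_finite_lborel]) auto
  then have f1: "AE t in lborel. f t \<le> 1"
  proof eventually_elim
    fix t assume "f t + f' t = 1"
    then show "f t \<le> 1" using add_mono[of "f t" "f t" 0 "f' t"] by simp
  qed
  \<comment> \<open>Truncation at one changes the density only on a null set, and makes the bound hold everywhere.\<close>
  define \<eta> where "\<eta> t = enn2real (min 1 (f t))" for t
  have e\<eta>: "ennreal (\<eta> t) = min 1 (f t)" for t
    unfolding \<eta>_def by (intro ennreal_enn2real le_less_trans[OF min.cobounded1]) simp
  have \<eta>[measurable]: "\<eta> \<in> borel_measurable borel" using f(1) unfolding \<eta>_def by measurable
  have \<eta>1: "\<eta> t \<le> 1" for t using e\<eta>[of t] by (simp add: \<eta>_def flip: ennreal_le_1)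
  have "(LINT t:{a<..b}|lborel. \<eta> t) = F b - F a" if ab: "a \<le> b" for a b
  proof -
    have "(LINT t:{a<..b}|lborel. \<eta> t) = enn2real (\<integral>\<^sup>+t. ennreal (indicator {a<..b} t *\<^sub>R \<eta> t) \<partial>lborel)"
      unfolding set_lebesgue_integral_def by (rule integral_eq_nn_integral) (auto simp: \<eta>_def)
    also have "(\<integral>\<^sup>+t. ennreal (indicator {a<..b} t *\<^sub>R \<eta> t) \<partial>lborel) = (\<integral>\<^sup>+t. f t * indicator {a<..b} t \<partial>lborel)"
      by (rule nn_integral_cong_AE) (use f1 in eventually_elim, auto simp: e\<eta> min_def split: split_indicator)
    also have "\<dots> = emeasure \<kappa> {a<..b}" by (simp add: df(1)[symmetric] emeasure_density)
    finally show ?thesis using m(1)[OF ab] by (simp add: ioc[OF ab])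
  qed
  then show ?thesis using that[of \<eta>] \<eta> \<eta>1 by (auto simp: \<eta>_def)
qed

text \<open>
Helly's theorem yields convergence only at continuity points of the limit. Continuity points are
dense, so the limit inherits the Lipschitz bound from the approximants, and then every point is a
continuity point.
\<close>

lemma phase_compactness:
  fixes \<xi> :: "nat \<Rightarrow> real \<Rightarrow> real"
  assumes meas[measurable]: "\<And>n. \<xi> n \<in> borel_measurable borel"
    and nn: "\<And>n t. 0 \<le> \<xi> n t" and le1: "\<And>n t. \<xi> n t \<le> 1" and neg: "\<And>n. \<forall>t<0. \<xi> n t = 0"
    and int: "\<And>n. integrable lborel (\<xi> n)" and C: "\<And>n. (LINT t|lborel. \<xi> n t) \<le> C"
  obtains \<sigma> \<eta> where "strict_mono (\<sigma> :: nat \<Rightarrow> nat)"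
    "\<eta> \<in> borel_measurable borel" "\<And>t. 0 \<le> \<eta> t" "\<And>t. \<eta> t \<le> 1" "\<forall>t<0. \<eta> t = 0"
    "integrable lborel \<eta>"
    "\<And>u. (\<lambda>n. LINT t:{..u}|lborel. \<xi> (\<sigma> n) t) \<longlonglongrightarrow> (LINT t:{..u}|lborel. \<eta> t)"
proof -
  define G where "G n u = (LINT t:{..u}|lborel. \<xi> n t)" for n u
  have si: "set_integrable lborel A (\<xi> n)" if "A \<in> sets borel" for A n
    unfolding set_integrable_def using that int by (intro integrable_mult_indicator) auto
  have inn: "0 \<le> (LINT t:A|lborel. \<xi> n t)" for A n
    unfolding set_lebesgue_integral_def by (simp add: integral_nonneg_AE nn)
  have Gdiff: "G n b - G n a = (LINT t:{a<..b}|lborel. \<xi> n t)" if "a \<le> b" for n a b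
  proof -
    have "{..b} = {..a} \<union> {a<..b}" using that by auto
    then show ?thesis unfolding G_def by (subst \<open>{..b} = _\<close>) (subst set_integral_Un, auto intro: si)
  qed
  have Gmono: "G n a \<le> G n b" if "a \<le> b" for n a b
    using Gdiff[OF that, of n] inn[of "{a<..b}" n] by simp
  have Glip: "G n b - G n a \<le> b - a" if "a \<le> b" for n a b
  proof -
    have "G n b - G n a \<le> (LINT t:{a<..b}|lborel. 1)"
      unfolding Gdiff[OF that] by (intro set_integral_mono si le1) (use that in \<open>auto simp: set_integrable_def integrable_indicator_iff\<close>)
    then show ?thesis using that by (simp add: set_lebesgue_integral_def)
  qed
  have G0: "G n u = 0" if "u \<le> 0" for n u
  proof -
    have "AE t in lborel. indicator {..u} t *\<^sub>R \<xi> n t = 0"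
      using AE_lborel_singleton[of 0] by eventually_elim (use that neg in \<open>auto simp: indicator_def\<close>)
    then show ?thesis unfolding G_def set_lebesgue_integral_def by (rule integral_eq_zero_AE)
  qed
  have GC: "G n u \<le> C" for n u
  proof -
    have "G n u \<le> (LINT t|lborel. \<xi> n t)" unfolding G_def set_lebesgue_integral_def
      using si[of "{..u}" n] by (intro integral_mono int) (auto simp: set_integrable_def nn split: split_indicator)
    then show ?thesis using C[of n] by simp
  qed
  have Gnn: "0 \<le> G n u" for n u unfolding G_def by (rule inn)
  have "continuous (at_right x) (G n)" for x n
  proof -
    have "\<bar>G n b - G n a\<bar> \<le> \<bar>b - a\<bar>" for a b
      using Glip[of a b n] Glip[of b a n] Gmono[of a b n] Gmono[of b a n] by linarith
    then show ?thesis by (rule continuous_within_if_nonexpansive)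
  qed
  moreover have "mono (G n)" for n using Gmono by (auto simp: mono_def)
  moreover have "\<bar>G n u\<bar> \<le> C" for n u using GC Gnn by simp
  ultimately obtain \<sigma> F where \<sigma>: "strict_mono (\<sigma> :: nat \<Rightarrow> nat)" and Frc: "\<And>x. continuous (at_right x) F"
    and F: "mono F" "\<And>x. \<bar>F x\<bar> \<le> C" and lim0: "\<And>x. continuous (at x) F \<Longrightarrow> (\<lambda>n. G (\<sigma> n) x) \<longlonglongrightarrow> F x"
    using Helly_selection[of G C] by blast
  have Flip: "F b - F a \<le> b - a" if ab: "a \<le> b" for a b
  proof (rule field_le_epsilon)
    fix e :: real assume e: "0 < e"
    have "(F \<longlongrightarrow> F a) (at_right a)" using Frc[of a] by (simp add: continuous_within)
    then have "eventually (\<lambda>x. F x < F a + e/2) (at_right a)" by (rule order_tendstoD) (use e in simp)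
    then obtain d where d: "d > a" "\<And>x. a < x \<Longrightarrow> x < d \<Longrightarrow> F x < F a + e/2"
      unfolding eventually_at_right_field by blast
    have dense: "\<exists>x\<in>{l<..<u}. isCont F x" if "l < u" for l u
    proof (rule ccontr)
      assume "\<not> ?thesis"
      then have "{l<..<u} \<subseteq> {x. \<not> isCont F x}" by auto
      then have "countable {l<..<u}" using mono_ctble_discont[OF F(1)] countable_subset by blast
      then show False using uncountable_open_interval[of l u] that by blast
    qed
    \<comment> \<open>Continuity points slightly to the right of \<open>a\<close> and of \<open>b\<close>.\<close>
    obtain a' where a': "a < a'" "a' < min d (a + e/2)" "isCont F a'" using dense[of a "min d (a + e/2)"] d e by auto
    obtain b' where b': "max b a' < b'" "b' < max b a' + e/2" "isCont F b'" using dense[of "max b a'" "max b a' + e/2"] e by auto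
    have "F b' - F a' \<le> b' - a'"
      by (rule tendsto_upperbound[OF tendsto_diff[OF lim0[OF b'(3)] lim0[OF a'(3)]]])
         (use b' in \<open>auto intro!: always_eventually Glip\<close>)
    moreover have "F b \<le> F b'" using monoD[OF F(1)] b' by auto
    ultimately have "F b - F a \<le> b' - a' + e/2" using d(2)[of a'] a' by linarith
    then show "F b - F a \<le> b - a + e" using a' b' ab by linarith
  qed
  have contF: "isCont F x" for x
  proof -
    have "\<bar>F b - F a\<bar> \<le> \<bar>b - a\<bar>" for a b
      using Flip[of a b] Flip[of b a] monoD[OF F(1), of a b] monoD[OF F(1), of b a] by linarith
    then show ?thesis by (rule continuous_within_if_nonexpansive)
  qed
  have lim: "(\<lambda>n. G (\<sigma> n) x) \<longlonglongrightarrow> F x" for x using lim0 contF by blast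
  have F0: "F x = 0" if "x \<le> 0" for x
    using lim[of x] G0[OF that] by (simp add: LIMSEQ_const_iff)
  obtain \<eta>0 where \<eta>0[measurable]: "\<eta>0 \<in> borel_measurable borel" and b0: "\<And>t. 0 \<le> \<eta>0 t" "\<And>t. \<eta>0 t \<le> 1"
    and i0: "\<And>a b. a \<le> b \<Longrightarrow> (LINT t:{a<..b}|lborel. \<eta>0 t) = F b - F a"
    using lipschitz_mono_density[OF F(1) Flip] by blast
  \<comment> \<open>The density may be nonzero on a null set of negative numbers; these values are cut off.\<close>
  define \<eta> where "\<eta> t = indicator {0<..} t * \<eta>0 t" for t
  have \<eta>[measurable]: "\<eta> \<in> borel_measurable borel" unfolding \<eta>_def by measurable
  have \<eta>F: "(LINT t:{..u}|lborel. \<eta> t) = F u" for u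
  proof (cases "u \<le> 0")
    case True
    then have "(LINT t:{..u}|lborel. \<eta> t) = (LINT t:{..u}|lborel. 0)"
      by (intro set_lebesgue_integral_cong) (auto simp: \<eta>_def)
    then show ?thesis using F0[OF True] by (simp add: set_lebesgue_integral_def)
  next
    case False
    have "(LINT t:{..u}|lborel. \<eta> t) = (LINT t:{0<..u}|lborel. \<eta>0 t)"
      unfolding set_lebesgue_integral_def by (intro Bochner_Integration.integral_cong) (auto simp: \<eta>_def indicator_def)
    then show ?thesis using i0[of 0 u] False F0[of 0] by simp
  qed
  have "integrable lborel \<eta>"
  proof (rule integrableI_nonneg)
    have sint: "integrable lborel (\<lambda>t. indicator {..real n} t *\<^sub>R \<eta> t)" for n
    proof (rule Bochner_Integration.integrable_bound)
      show "integrable lborel (indicator {0..real n} :: real \<Rightarrow> real)" by simp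
    qed (auto simp: \<eta>_def b0 split: split_indicator)
    have "(\<integral>\<^sup>+t. ennreal (\<eta> t) \<partial>lborel) = (\<integral>\<^sup>+t. (SUP n. ennreal (indicator {..real n} t *\<^sub>R \<eta> t)) \<partial>lborel)"
    proof (intro nn_integral_cong)
      fix t :: real
      obtain n where n: "t \<le> real n" using real_arch_simple by blast
      show "ennreal (\<eta> t) = (SUP n. ennreal (indicator {..real n} t *\<^sub>R \<eta> t))"
        by (intro antisym SUP_upper2[of n] SUP_least) (use n b0 in \<open>auto simp: \<eta>_def indicator_def\<close>)
    qed
    also have "\<dots> = (SUP n. \<integral>\<^sup>+t. ennreal (indicator {..real n} t *\<^sub>R \<eta> t) \<partial>lborel)"
      by (rule nn_integral_monotone_convergence_SUP)
         (auto simp: incseq_def le_fun_def \<eta>_def b0 intro!: ennreal_leI split: split_indicator)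
    also have "\<dots> \<le> ennreal C"
    proof (rule SUP_least)
      fix n
      have "(\<integral>\<^sup>+t. ennreal (indicator {..real n} t *\<^sub>R \<eta> t) \<partial>lborel) = ennreal (F (real n))"
        unfolding \<eta>F[symmetric] set_lebesgue_integral_def
        by (rule nn_integral_eq_integral[OF sint]) (auto simp: \<eta>_def b0)
      also have "\<dots> \<le> ennreal C" using F(2)[of n] by (intro ennreal_leI) auto
      finally show "(\<integral>\<^sup>+t. ennreal (indicator {..real n} t *\<^sub>R \<eta> t) \<partial>lborel) \<le> ennreal C" .
    qed
    finally show "(\<integral>\<^sup>+t. ennreal (\<eta> t) \<partial>lborel) < \<infinity>" by (simp add: le_less_trans)
  qed (auto simp: \<eta>_def b0)
  moreover have "0 \<le> \<eta> t" "\<eta> t \<le> 1" "\<forall>t<0. \<eta> t = 0" for t using b0[of t] by (auto simp: \<eta>_def indicator_def)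
  ultimately show ?thesis
    using that[of \<sigma> \<eta>] \<sigma> \<eta> lim unfolding G_def \<eta>F by blast
qed

text \<open>
Fubini's theorem on the region \<open>t \<le> u\<close>: integration by parts without derivatives.
\<close>

lemma integral_tail_kernel:
  fixes k :: "real \<Rightarrow> 'a::{banach, second_countable_topology}"
  assumes \<xi>: "integrable lborel \<xi>" and k: "integrable lborel k"
  shows "(LINT t|lborel. \<xi> t *\<^sub>R (LINT u:{t..}|lborel. k u)) = (LINT u|lborel. (LINT t:{..u}|lborel. \<xi> t) *\<^sub>R k u)"
proof -
  have [measurable]: "\<xi> \<in> borel_measurable borel" "k \<in> borel_measurable borel" using \<xi> k by auto
  define f where "f = (\<lambda>t u. (indicator {t..} u * \<xi> t) *\<^sub>R k u)"
  have ind: "(\<lambda>p::real \<times> real. indicator {fst p..} (snd p) :: real) \<in> borel_measurable (lborel \<Otimes>\<^sub>M lborel)"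
  proof -
    have "(\<lambda>p::real \<times> real. indicator {fst p..} (snd p) :: real) = (\<lambda>p. if fst p \<le> snd p then 1 else 0)"
      by (auto simp: indicator_def fun_eq_iff)
    then show ?thesis by simp
  qed
  have fm: "(\<lambda>p. f (fst p) (snd p)) \<in> borel_measurable (lborel \<Otimes>\<^sub>M lborel)"
    unfolding f_def by (intro borel_measurable_scaleR borel_measurable_times ind) auto
  have int: "integrable (lborel \<Otimes>\<^sub>M lborel) (case_prod f)"
  proof (rule Bochner_Integration.integrable_bound)
    have "integrable lborel (\<lambda>x. \<integral>y. norm (\<xi> x *\<^sub>R k y) \<partial>lborel)"
      using \<xi> k by simp
    then show "integrable (lborel \<Otimes>\<^sub>M lborel) (\<lambda>(t,u). \<xi> t *\<^sub>R k u)"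
      by (intro lborel_pair.Fubini_integrable) (use k in auto)
    show "case_prod f \<in> borel_measurable (lborel \<Otimes>\<^sub>M lborel)" using fm by (simp add: case_prod_beta')
    show "AE x in lborel \<Otimes>\<^sub>M lborel. norm (case_prod f x) \<le> norm ((\<lambda>(t,u). \<xi> t *\<^sub>R k u) x)"
      by (auto simp: f_def split: split_indicator)
  qed
  have "(LINT t|lborel. \<xi> t *\<^sub>R (LINT u:{t..}|lborel. k u)) = (LINT t|lborel. LINT u|lborel. f t u)"
    unfolding set_lebesgue_integral_def f_def
    by (simp only: integral_scaleR_right[symmetric] scaleR_scaleR mult.commute)
  also have "\<dots> = (LINT u|lborel. LINT t|lborel. f t u)"
    by (rule lborel_pair.Fubini_integral[OF int, symmetric])
  also have "\<dots> = (LINT u|lborel. (LINT t:{..u}|lborel. \<xi> t) *\<^sub>R k u)"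
  proof (rule Bochner_Integration.integral_cong[OF refl])
    fix u
    have "f t u = (indicator {..u} t *\<^sub>R \<xi> t) *\<^sub>R k u" for t by (simp add: f_def indicator_def)
    moreover have "integrable lborel (\<lambda>t. indicator {..u} t *\<^sub>R \<xi> t)"
      by (rule integrable_mult_indicator[OF _ \<xi>]) simp
    ultimately show "(LINT t|lborel. f t u) = (LINT t:{..u}|lborel. \<xi> t) *\<^sub>R k u"
      by (simp only: set_lebesgue_integral_def integral_scaleR_left)
  qed
  finally show ?thesis .
qed

lemma weak_convergence_from_cdf:
  fixes k :: "real \<Rightarrow> 'a::{banach, second_countable_topology}"
  assumes k: "integrable lborel k"
    and int: "\<And>n. integrable lborel (\<xi> n)" "integrable lborel \<eta>"
    and bound: "\<And>n u. \<bar>LINT t:{..u}|lborel. \<xi> n t\<bar> \<le> C"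
    and lim: "\<And>u. (\<lambda>n. LINT t:{..u}|lborel. \<xi> n t) \<longlonglongrightarrow> (LINT t:{..u}|lborel. \<eta> t)"
  shows "(\<lambda>n. LINT t|lborel. \<xi> n t *\<^sub>R (LINT u:{t..}|lborel. k u)) \<longlonglongrightarrow> (LINT t|lborel. \<eta> t *\<^sub>R (LINT u:{t..}|lborel. k u))"
  unfolding integral_tail_kernel[OF int(1) k] integral_tail_kernel[OF int(2) k]
proof (rule integral_dominated_convergence[where w="\<lambda>u. C * norm (k u)"])
  have cdf: "(\<lambda>u. LINT t:{..u}|lborel. \<zeta> t) \<in> borel_measurable borel" if "integrable lborel \<zeta>" for \<zeta> :: "real \<Rightarrow> real"
  proof -
    have [measurable]: "\<zeta> \<in> borel_measurable borel" using that by auto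
    have "(\<lambda>u. LINT t|lborel. (if t \<le> u then \<zeta> t else 0)) \<in> borel_measurable borel" by measurable
    moreover have "(LINT t:{..u}|lborel. \<zeta> t) = (LINT t|lborel. (if t \<le> u then \<zeta> t else 0))" for u
      unfolding set_lebesgue_integral_def by (intro Bochner_Integration.integral_cong) (auto simp: indicator_def)
    ultimately show ?thesis by simp
  qed
  have [measurable]: "k \<in> borel_measurable borel" using k by auto
  show "(\<lambda>u. (LINT t:{..u}|lborel. \<xi> n t) *\<^sub>R k u) \<in> borel_measurable lborel" for n
    using cdf[OF int(1)] by simp
  show "(\<lambda>u. (LINT t:{..u}|lborel. \<eta> t) *\<^sub>R k u) \<in> borel_measurable lborel"
    using cdf[OF int(2)] by simp
  show "integrable lborel (\<lambda>u. C * norm (k u))" using k by simp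
  show "AE u in lborel. (\<lambda>n. (LINT t:{..u}|lborel. \<xi> n t) *\<^sub>R k u) \<longlonglongrightarrow> (LINT t:{..u}|lborel. \<eta> t) *\<^sub>R k u"
    by (auto intro!: always_eventually tendsto_scaleR lim)
  show "AE u in lborel. norm ((LINT t:{..u}|lborel. \<xi> n t) *\<^sub>R k u) \<le> C * norm (k u)" for n
    by (auto intro!: always_eventually mult_right_mono bound)
qed

text \<open>
For \<open>t \<ge> 0\<close> the function \<open>t ^ n * (1 - t / T)\<close> lies below \<open>t ^ n\<close>, and it vanishes at \<open>T\<close>. Its
continuation by zero beyond \<open>T\<close> is thus the tail integral of the bounded, compactly supported function \<open>k\<close>.
\<close>

lemma cutoff_monomial_tail:
  fixes T :: real and n :: nat
  assumes T: "0 < T"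
  defines "k \<equiv> \<lambda>u. indicator {0..T} u * (real (Suc n) * u ^ n / T - real n * u ^ (n - 1))"
  shows "integrable lborel k"
    "0 \<le> t \<Longrightarrow> (LINT u:{t..}|lborel. k u) = (if t \<le> T then t ^ n - t ^ Suc n / T else 0)"
proof -
  define f where "f u = real (Suc n) * u ^ n / T - real n * u ^ (n - 1)" for u
  have f: "continuous_on X f" for X unfolding f_def using T by (intro continuous_intros) auto
  have k: "k = (\<lambda>u. indicator {0..T} u *\<^sub>R f u)" by (simp add: k_def f_def)
  show "integrable lborel k"
    using borel_integrable_atLeastAtMost'[OF f] by (simp add: k set_integrable_def)
  assume t: "0 \<le> t"
  show "(LINT u:{t..}|lborel. k u) = (if t \<le> T then t ^ n - t ^ Suc n / T else 0)"
  proof (cases "t \<le> T")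
    case True
    have "((\<lambda>u. u ^ Suc n / T - u ^ n) has_vector_derivative f x) (at x within {t..T})" for x
      unfolding has_real_derivative_iff_has_vector_derivative[symmetric] f_def
      by (intro DERIV_diff has_field_derivative_at_within[OF DERIV_cdivide] has_field_derivative_at_within[OF DERIV_pow])
         (use DERIV_pow[of "Suc n" x] DERIV_pow[of n x] in \<open>simp_all add: has_field_derivative_at_within\<close>)
    then have "(LINT u|lborel. indicator {t..T} u *\<^sub>R f u) = (T ^ Suc n / T - T ^ n) - (t ^ Suc n / T - t ^ n)"
      by (intro integral_FTC_atLeastAtMost True f)
    moreover have "indicator {t..} u *\<^sub>R k u = indicator {t..T} u *\<^sub>R f u" for u
      using t by (auto simp: k indicator_def)
    ultimately show ?thesis using T True by (simp add: set_lebesgue_integral_def)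
  next
    case False
    then have "(\<lambda>u. indicator {t..} u *\<^sub>R k u) = (\<lambda>u. 0)" by (auto simp: k indicator_def)
    then show ?thesis using False unfolding set_lebesgue_integral_def by simp
  qed
qed

text \<open>
A truncated monomial is at most \<open>t ^ n\<close>, so its integrals against the approximants are bounded by \<open>K\<close>, and
so is the limiting integral. It is at least \<open>t ^ n / 2\<close> on the first half of its
support, which accounts for the factor two; monotone convergence does the rest.
\<close>

lemma moment_of_weak_limit:
  fixes \<xi> :: "nat \<Rightarrow> real \<Rightarrow> real"
  assumes \<xi>: "\<And>i t. 0 \<le> \<xi> i t" "\<And>i. \<forall>t<0. \<xi> i t = 0" and int: "\<And>i. integrable lborel (\<xi> i)"
    and \<eta>: "\<eta> \<in> borel_measurable borel" "\<And>t. 0 \<le> \<eta> t" "\<forall>t<0. \<eta> t = 0" "integrable lborel \<eta>"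
    and bound: "\<And>i u. \<bar>LINT t:{..u}|lborel. \<xi> i t\<bar> \<le> C"
    and lim: "\<And>u. (\<lambda>i. LINT t:{..u}|lborel. \<xi> i t) \<longlonglongrightarrow> (LINT t:{..u}|lborel. \<eta> t)"
    and mom: "\<And>i. integrable lborel (\<lambda>t. t ^ n * \<xi> i t)" and mK: "\<And>i. (LINT t|lborel. t ^ n * \<xi> i t) \<le> K"
  shows "(\<integral>\<^sup>+t. ennreal (t ^ n * \<eta> t) \<partial>lborel) \<le> ennreal (2 * K)"
proof -
  note [measurable] = \<eta>(1)
  have tn: "0 \<le> t ^ n * \<zeta> t" if "\<And>t. 0 \<le> \<zeta> t" "\<forall>t<0. \<zeta> t = 0" for \<zeta> :: "real \<Rightarrow> real" and t
    using that by (cases "t < 0") auto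
  have part: "(\<integral>\<^sup>+t. ennreal (t ^ n * \<eta> t) * indicator {..real j} t \<partial>lborel) \<le> ennreal (2 * K)" for j
  proof -
    \<comment> \<open>With this \<open>T\<close> the interval from \<open>0\<close> to \<open>j\<close> lies in the first half of the support.\<close>
    define T where "T = 2 * (real j + 1)"
    have T: "0 < T" by (simp add: T_def)
    define k where "k u = indicator {0..T} u * (real (Suc n) * u ^ n / T - real n * u ^ (n - 1))" for u
    define \<phi> where "\<phi> t = (LINT u:{t..}|lborel. k u)" for t
    note cm = cutoff_monomial_tail[OF T, where n=n, folded k_def, folded \<phi>_def]
    have \<phi>: "0 \<le> \<phi> t" "\<phi> t \<le> t ^ n" "t \<le> real j \<Longrightarrow> t ^ n \<le> 2 * \<phi> t" if t: "0 \<le> t" for t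
    proof -
      have e: "t ^ n - t ^ Suc n / T = t ^ n * (1 - t / T)" by (simp add: algebra_simps)
      show "0 \<le> \<phi> t" unfolding cm(2)[OF t] e using t T by auto
      show "\<phi> t \<le> t ^ n" unfolding cm(2)[OF t] using t T by auto
      assume "t \<le> real j"
      then have "1 / 2 \<le> 1 - t / T" "t \<le> T" using t by (auto simp: T_def field_simps)
      moreover from this t have "t ^ n * (1 / 2) \<le> t ^ n * (1 - t / T)" by (intro mult_left_mono) auto
      ultimately have "t ^ n * (1 / 2) \<le> \<phi> t" unfolding cm(2)[OF t] e by simp
      then show "t ^ n \<le> 2 * \<phi> t" by simp
    qed
    have \<phi>m: "\<phi> \<in> borel_measurable borel"
    proof -
      have [measurable]: "k \<in> borel_measurable borel" using cm(1) by auto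
      have "(\<lambda>t. LINT u|lborel. (if t \<le> u then k u else 0)) \<in> borel_measurable borel" by measurable
      moreover have "\<phi> t = (LINT u|lborel. (if t \<le> u then k u else 0))" for t
        unfolding \<phi>_def set_lebesgue_integral_def by (intro Bochner_Integration.integral_cong) (auto simp: indicator_def)
      ultimately show ?thesis by (simp cong: measurable_cong)
    qed
    note [measurable] = \<phi>m borel_measurable_integrable[OF int, simplified]
    have nn\<phi>: "0 \<le> \<zeta> t * \<phi> t" if "\<And>t. 0 \<le> \<zeta> t" "\<forall>t<0. \<zeta> t = 0" for \<zeta> :: "real \<Rightarrow> real" and t
      using that \<phi>(1) by (cases "t < 0") auto
    have le\<phi>: "\<zeta> t * \<phi> t \<le> t ^ n * \<zeta> t" if "\<And>t. 0 \<le> \<zeta> t" "\<forall>t<0. \<zeta> t = 0" for \<zeta> :: "real \<Rightarrow> real" and t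
    proof (cases "t < 0")
      case False
      then show ?thesis using mult_left_mono[OF \<phi>(2)[of t] that(1)[of t]] by (simp add: mult.commute)
    qed (use that in auto)
    have i\<xi>: "integrable lborel (\<lambda>t. \<xi> i t * \<phi> t)" for i
      by (rule Bochner_Integration.integrable_bound[OF mom[of i]])
         (use nn\<phi>[of "\<xi> i"] le\<phi>[of "\<xi> i"] tn[of "\<xi> i"] \<xi> in \<open>auto intro!: always_eventually simp: abs_of_nonneg\<close>)
    have "(LINT t|lborel. \<xi> i t * \<phi> t) \<le> K" for i
      using integral_mono[OF i\<xi>[of i] mom[of i] le\<phi>[of "\<xi> i"]] mK[of i] \<xi> by (meson order_trans)
    moreover have "(\<lambda>i. LINT t|lborel. \<xi> i t * \<phi> t) \<longlonglongrightarrow> (LINT t|lborel. \<eta> t * \<phi> t)"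
      using weak_convergence_from_cdf[OF cm(1) int \<eta>(4) bound lim] by (simp add: \<phi>_def)
    ultimately have le: "(LINT t|lborel. \<eta> t * \<phi> t) \<le> K"
      by (intro LIMSEQ_le_const2) auto
    have i\<eta>: "integrable lborel (\<lambda>t. \<eta> t * \<phi> t)"
    proof (rule Bochner_Integration.integrable_bound)
      show "integrable lborel (\<lambda>t. T ^ n * \<eta> t)" using \<eta>(4) by simp
      show "AE t in lborel. norm (\<eta> t * \<phi> t) \<le> norm (T ^ n * \<eta> t)"
      proof (rule always_eventually, rule allI)
        fix t
        have "\<phi> t \<le> T ^ n" if "0 \<le> t"
        proof (cases "t \<le> T")
          case True
          then show ?thesis using \<phi>(2)[OF that] power_mono[OF True that, of n] by linarith
        qed (use cm(2)[OF that] T in auto)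
        then show "norm (\<eta> t * \<phi> t) \<le> norm (T ^ n * \<eta> t)"
          using \<eta>(2)[of t] \<eta>(3) \<phi>(1)[of t] T
          by (cases "t < 0") (auto simp: abs_mult mult.commute[of "T ^ n"] intro!: mult_left_mono)
      qed
    qed simp
    have "(\<integral>\<^sup>+t. ennreal (t ^ n * \<eta> t) * indicator {..real j} t \<partial>lborel) \<le> (\<integral>\<^sup>+t. ennreal (2 * (\<eta> t * \<phi> t)) \<partial>lborel)"
    proof (rule nn_integral_mono)
      fix t :: real
      show "ennreal (t ^ n * \<eta> t) * indicator {..real j} t \<le> ennreal (2 * (\<eta> t * \<phi> t))"
      proof (cases "0 \<le> t \<and> t \<le> real j")
        case True
        then have "t ^ n * \<eta> t \<le> 2 * (\<eta> t * \<phi> t)"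
          using mult_left_mono[OF \<phi>(3)[of t] \<eta>(2)[of t]] by (simp add: mult_ac)
        then show ?thesis using True by (auto intro: ennreal_leI)
      qed (use \<eta>(3) in \<open>auto simp: indicator_def\<close>)
    qed
    also have "\<dots> = ennreal (LINT t|lborel. 2 * (\<eta> t * \<phi> t))"
      using i\<eta> nn\<phi>[of \<eta>] \<eta> by (intro nn_integral_eq_integral) auto
    also have "\<dots> \<le> ennreal (2 * K)" using le by (intro ennreal_leI) simp
    finally show ?thesis .
  qed
  have "(\<integral>\<^sup>+t. ennreal (t ^ n * \<eta> t) \<partial>lborel) = (\<integral>\<^sup>+t. (SUP j. ennreal (t ^ n * \<eta> t) * indicator {..real j} t) \<partial>lborel)"
  proof (intro nn_integral_cong)
    fix t :: real
    obtain j where j: "t \<le> real j" using real_arch_simple by blast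
    show "ennreal (t ^ n * \<eta> t) = (SUP j. ennreal (t ^ n * \<eta> t) * indicator {..real j} t)"
      by (intro antisym SUP_upper2[of j] SUP_least) (use j in \<open>auto simp: indicator_def\<close>)
  qed
  also have "\<dots> = (SUP j. \<integral>\<^sup>+t. ennreal (t ^ n * \<eta> t) * indicator {..real j} t \<partial>lborel)"
    by (rule nn_integral_monotone_convergence_SUP)
       (auto simp: incseq_def le_fun_def intro!: mult_left_mono split: split_indicator)
  also have "\<dots> \<le> ennreal (2 * K)" by (rule SUP_least) (rule part)
  finally show ?thesis .
qed

section \<open>The exponential representation on the half-line\<close>

text \<open>
Values taken with measure zero are left out of \<open>A\<close>: the interlacing of zeros and poles is strict only
for positive masses.
\<close>

lemma integral_finite_range:
  fixes g :: "real \<Rightarrow> 'b::{banach, second_countable_topology}"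
  assumes h: "simple_function M h" and fin: "finite_measure M"
  defines "m \<equiv> \<lambda>a. measure M (h -` {a} \<inter> space M)"
  defines "A \<equiv> {a \<in> h ` space M. 0 < m a}"
  shows "integrable M (\<lambda>s. g (h s))" "(LINT s|M. g (h s)) = (\<Sum>a\<in>A. m a *\<^sub>R g a)"
proof -
  interpret finite_measure M by fact
  have H: "finite (h ` space M)" using h by (simp add: simple_function_def)
  have meas: "h -` {a} \<inter> space M \<in> sets M" for a using simple_functionD(2)[OF h] by blast
  have eq: "g (h s) = (\<Sum>a\<in>h ` space M. indicator (h -` {a} \<inter> space M) s *\<^sub>R g a)" if "s \<in> space M" for s
    using that H by (subst sum.remove[of _ "h s"]) (auto simp: indicator_def intro!: sum.neutral)
  have i: "integrable M (\<lambda>s. indicator (h -` {a} \<inter> space M) s *\<^sub>R g a)" for a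
    using meas by (intro integrable_scaleR_left) (simp add: emeasure_eq_measure integrable_indicator_iff)
  then have "integrable M (\<lambda>s. \<Sum>a\<in>h ` space M. indicator (h -` {a} \<inter> space M) s *\<^sub>R g a)"
    by (intro Bochner_Integration.integrable_sum)
  then show "integrable M (\<lambda>s. g (h s))" by (subst Bochner_Integration.integrable_cong[OF refl eq])
  have "(LINT s|M. g (h s)) = (LINT s|M. (\<Sum>a\<in>h ` space M. indicator (h -` {a} \<inter> space M) s *\<^sub>R g a))"
    by (rule Bochner_Integration.integral_cong[OF refl eq])
  also have "\<dots> = (\<Sum>a\<in>h ` space M. m a *\<^sub>R g a)"
    using meas by (subst Bochner_Integration.integral_sum)
      (auto simp: m_def i emeasure_eq_measure intro!: sum.cong)
  also have "\<dots> = (\<Sum>a\<in>A. m a *\<^sub>R g a)"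
    unfolding A_def using H by (intro sum.mono_neutral_right) (auto simp: m_def zero_less_measure_iff)
  finally show "(LINT s|M. g (h s)) = (\<Sum>a\<in>A. m a *\<^sub>R g a)" .
qed

text \<open>
The simple functions \<open>h i\<close> increase to the identity on the half-line. Their images of \<open>\<nu>\<close>
have finitely many atoms, the same mass as \<open>\<nu>\<close>, and moments bounded by those of \<open>\<nu>\<close>, so the
phases of these images have uniformly bounded moments and a weak limit.
\<close>

theorem stieltjes_phase:
  fixes \<nu> :: "real measure"
  assumes s\<nu>: "sets \<nu> = sets borel" and fin: "finite_measure \<nu>" and pos: "AE s in \<nu>. 0 \<le> s"
  obtains \<xi> where
    "\<xi> \<in> borel_measurable borel" "\<And>t. 0 \<le> \<xi> t" "\<And>t. \<xi> t \<le> 1" "\<forall>t<0. \<xi> t = 0" "integrable lborel \<xi>"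
    "\<And>z. 0 < Im z \<Longrightarrow> 1 + (LINT s|\<nu>. 1 / (complex_of_real s - z)) = exp (LINT t|lborel. \<xi> t *\<^sub>R (1 / (complex_of_real t - z)))"
    "\<And>n. integrable \<nu> (\<lambda>s. s ^ n) \<Longrightarrow> (\<integral>\<^sup>+t. ennreal (t ^ n * \<xi> t) \<partial>lborel) < \<infinity>"
proof -
  interpret \<nu>: finite_measure \<nu> by fact
  note [measurable_cong] = s\<nu>
  have sp: "space \<nu> = UNIV" using sets_eq_imp_space_eq[OF s\<nu>] by simp
  have "(\<lambda>t::real. max 0 t) \<in> borel_measurable \<nu>" by measurable
  then obtain h where h: "incseq h" "\<And>i. simple_function \<nu> (h i)" "\<And>x. bdd_above (range (\<lambda>i. h i x))"
      "\<And>i x. 0 \<le> h i x" and hsup: "(\<lambda>t::real. max 0 t) = (SUP i. h i)"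
    using borel_measurable_implies_simple_function_sequence_real[of "\<lambda>t::real. max 0 t" \<nu>] by auto
  have hsup': "max 0 t = (SUP i. h i t)" for t :: real
    using fun_cong[OF hsup, of t] by (simp add: image_image)
  have hlim: "(\<lambda>i. h i t) \<longlonglongrightarrow> max 0 t" for t
    unfolding hsup' using h(1,3) by (intro LIMSEQ_incseq_SUP) (auto simp: incseq_def le_fun_def)
  have hle: "h i t \<le> max 0 t" for i t
    unfolding hsup' using h(3) by (intro cSUP_upper) auto
  define m where "m i a = measure \<nu> (h i -` {a} \<inter> space \<nu>)" for i a
  define A where "A i = {a \<in> h i ` space \<nu>. 0 < m i a}" for i
  note ih = integral_finite_range[OF h(2) fin, folded m_def, folded A_def]
  have finA: "finite (A i)" for i using h(2)[of i] by (auto simp: A_def simple_function_def)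
  define P where "P i \<xi> D \<longleftrightarrow> \<xi> \<in> borel_measurable borel \<and> (\<forall>t. 0 \<le> \<xi> t) \<and> (\<forall>t. \<xi> t \<le> 1) \<and> (\<forall>t<0. \<xi> t = 0) \<and>
    (\<forall>z. 0 < Im z \<longrightarrow> 1 + (\<Sum>s\<in>A i. of_real (m i s) / (of_real s - z)) = exp (LINT t|lborel. \<xi> t *\<^sub>R (1 / (complex_of_real t - z)))) \<and>
    (\<forall>n. integrable lborel (\<lambda>t. t ^ n * \<xi> t)) \<and> (\<forall>n. (LINT t|lborel. t ^ n * \<xi> t) = D n / real (Suc n)) \<and>
    (\<forall>n. D n = real (Suc n) * (\<Sum>s\<in>A i. m i s * s ^ n) + (\<Sum>j<n. (\<Sum>s\<in>A i. m i s * s ^ j) * D (n - Suc j))) \<and>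
    (\<forall>n. 0 \<le> D n)" for i \<xi> D
  have "\<exists>\<xi> D. P i \<xi> D" for i
  proof -
    have 1: "\<And>s. s \<in> A i \<Longrightarrow> 0 \<le> s" "\<forall>s\<in>A i. 0 < m i s" using h(4) by (auto simp: A_def)
    show ?thesis unfolding P_def by (rule discrete_phase[OF finA[of i] 1]) blast+
  qed
  then obtain \<xi> D where P: "\<And>i. P i (\<xi> i) (D i)" by metis
  have \<xi>: "\<xi> i \<in> borel_measurable borel" "0 \<le> \<xi> i t" "\<xi> i t \<le> 1" "\<forall>t<0. \<xi> i t = 0" for i t
    using P[of i] unfolding P_def by blast+
  have rep: "1 + (\<Sum>s\<in>A i. of_real (m i s) / (of_real s - z)) = exp (LINT t|lborel. \<xi> i t *\<^sub>R (1 / (complex_of_real t - z)))"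
    if "0 < Im z" for i z
    using P[of i] that unfolding P_def by blast
  have mom: "integrable lborel (\<lambda>t. t ^ n * \<xi> i t)" "(LINT t|lborel. t ^ n * \<xi> i t) = D i n / real (Suc n)" for i n
    using P[of i] unfolding P_def by blast+
  have Drec: "D i n = real (Suc n) * (\<Sum>s\<in>A i. m i s * s ^ n) + (\<Sum>j<n. (\<Sum>s\<in>A i. m i s * s ^ j) * D i (n - Suc j))"
    and Dnn: "0 \<le> D i n" for i n
    using P[of i] unfolding P_def by blast+
  have int: "integrable lborel (\<xi> i)" for i using mom(1)[of 0 i] by simp
  have M: "(\<Sum>s\<in>A i. m i s * s ^ n) = (LINT s|\<nu>. h i s ^ n)" for i n
    using ih(2)[of "\<lambda>a. a ^ n" i] by simp
  define C where "C = measure \<nu> (space \<nu>)"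
  have mass: "(LINT t|lborel. \<xi> i t) = C" for i
  proof -
    have "D i 0 = (\<Sum>s\<in>A i. m i s * s ^ 0)" by (subst Drec) simp
    also have "\<dots> = C" unfolding M by (simp add: C_def)
    finally show ?thesis using mom(2)[of 0 i] by simp
  qed
  obtain \<sigma> \<eta> where \<sigma>: "strict_mono (\<sigma> :: nat \<Rightarrow> nat)"
    and \<eta>: "\<eta> \<in> borel_measurable borel" "\<And>t. 0 \<le> \<eta> t" "\<And>t. \<eta> t \<le> 1" "\<forall>t<0. \<eta> t = 0" "integrable lborel \<eta>"
    and lim: "\<And>u. (\<lambda>n. LINT t:{..u}|lborel. \<xi> (\<sigma> n) t) \<longlonglongrightarrow> (LINT t:{..u}|lborel. \<eta> t)"
    by (rule phase_compactness[of \<xi> C, OF \<xi> int eq_refl[OF mass]]) (rule that)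
  note [measurable] = \<eta>(1)
  have cdf: "\<bar>LINT t:{..u}|lborel. \<xi> (\<sigma> n) t\<bar> \<le> C" for n u
  proof -
    have "\<bar>LINT t:{..u}|lborel. \<xi> (\<sigma> n) t\<bar> = (LINT t:{..u}|lborel. \<xi> (\<sigma> n) t)"
      unfolding set_lebesgue_integral_def using \<xi>(2) by (simp add: integral_nonneg_AE)
    also have "\<dots> \<le> (LINT t|lborel. \<xi> (\<sigma> n) t)"
      unfolding set_lebesgue_integral_def using int \<xi>(2)
      by (intro integral_mono integrable_mult_indicator) (auto split: split_indicator)
    finally show ?thesis using mass by simp
  qed
  note conv = weak_convergence_from_cdf[OF _ int \<eta>(5) cdf lim]
  show ?thesis
  proof (rule that[OF \<eta>])
    fix z assume z: "0 < Im z"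
    note nz = of_real_minus_nonreal_neq_0[OF z]
    have "(\<lambda>i. 1 + (LINT s|\<nu>. 1 / (complex_of_real (h (\<sigma> i) s) - z))) \<longlonglongrightarrow> 1 + (LINT s|\<nu>. 1 / (complex_of_real (max 0 s) - z))"
    proof (intro tendsto_add tendsto_const integral_dominated_convergence[where w="\<lambda>_. 1 / Im z"])
      show "AE s in \<nu>. (\<lambda>i. 1 / (complex_of_real (h (\<sigma> i) s) - z)) \<longlonglongrightarrow> 1 / (complex_of_real (max 0 s) - z)"
        using LIMSEQ_subseq_LIMSEQ[OF hlim \<sigma>] nz(1)
        by (intro always_eventually allI tendsto_intros) (auto simp: o_def)
      show "(\<lambda>s. 1 / (complex_of_real (h (\<sigma> i) s) - z)) \<in> borel_measurable \<nu>" for i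
        using borel_measurable_simple_function[OF h(2)] by measurable
    qed (auto intro!: always_eventually norm_cauchy_kernel_le z)
    moreover have "(LINT s|\<nu>. 1 / (complex_of_real (max 0 s) - z)) = (LINT s|\<nu>. 1 / (complex_of_real s - z))"
      by (rule integral_cong_AE) (use pos in \<open>auto elim!: eventually_mono\<close>)
    moreover have "1 + (LINT s|\<nu>. 1 / (complex_of_real (h i s) - z)) = exp (LINT t|lborel. \<xi> i t *\<^sub>R (1 / (complex_of_real t - z)))" for i
    proof -
      have "(LINT s|\<nu>. 1 / (complex_of_real (h i s) - z)) = (\<Sum>s\<in>A i. of_real (m i s) / (of_real s - z))"
        using ih(2)[of "\<lambda>a. 1 / (complex_of_real a - z)" i] by (simp add: scaleR_conv_of_real)
      then show ?thesis using rep[OF z, of i] by simp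
    qed
    ultimately have 1: "(\<lambda>i. exp (LINT t|lborel. \<xi> (\<sigma> i) t *\<^sub>R (1 / (complex_of_real t - z)))) \<longlonglongrightarrow> 1 + (LINT s|\<nu>. 1 / (complex_of_real s - z))"
      by simp
    have "(\<lambda>i. LINT t|lborel. \<xi> (\<sigma> i) t *\<^sub>R (1 / (complex_of_real t - z))) \<longlonglongrightarrow> (LINT t|lborel. \<eta> t *\<^sub>R (1 / (complex_of_real t - z)))"
      using conv[OF cauchy_kernel_tail(1)[OF z]] unfolding cauchy_kernel_tail(2)[OF z] .
    from tendsto_unique[OF _ 1 tendsto_exp[OF this]]
    show "1 + (LINT s|\<nu>. 1 / (complex_of_real s - z)) = exp (LINT t|lborel. \<eta> t *\<^sub>R (1 / (complex_of_real t - z)))"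
      by simp
  next
    fix n assume sn: "integrable \<nu> (\<lambda>s. s ^ n)"
    \<comment> \<open>One bound for all lower moments as well, since \<open>\<bar>s\<bar> ^ k \<le> 1 + \<bar>s\<bar> ^ n\<close> for \<open>k \<le> n\<close>.\<close>
    define b where "b = (LINT s|\<nu>. 1 + \<bar>s\<bar> ^ n)"
    have ib: "integrable \<nu> (\<lambda>s. 1 + \<bar>s\<bar> ^ n)" using integrable_abs[OF sn] by (simp add: power_abs)
    have Mb: "(LINT s|\<nu>. h i s ^ k) \<le> b" if "k \<le> n" for i k
      unfolding b_def
    proof (rule integral_mono_AE[OF _ ib])
      show "integrable \<nu> (\<lambda>s. h i s ^ k)" using ih(1)[of "\<lambda>a. a ^ k" i] .
      show "AE s in \<nu>. h i s ^ k \<le> 1 + \<bar>s\<bar> ^ n"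
      proof (rule always_eventually, rule allI)
        fix s
        have "h i s ^ k \<le> \<bar>s\<bar> ^ k" using hle[of i s] h(4)[of i s] by (intro power_mono) auto
        also have "\<dots> \<le> 1 + \<bar>s\<bar> ^ n"
        proof (cases "\<bar>s\<bar> \<le> 1")
          case True
          then show ?thesis using power_le_one[of "\<bar>s\<bar>" k] zero_le_power[of "\<bar>s\<bar>" n] by linarith
        next
          case False
          then show ?thesis using power_increasing[OF that, of "\<bar>s\<bar>"] by linarith
        qed
        finally show "h i s ^ k \<le> 1 + \<bar>s\<bar> ^ n" .
      qed
    qed
    have Mnn: "0 \<le> (LINT s|\<nu>. h i s ^ k)" for i k using h(4) by (simp add: integral_nonneg_AE)
    obtain K where K: "\<And>D M. (\<forall>k. D k = real (Suc k) * M k + (\<Sum>j<k. M j * D (k - Suc j))) \<Longrightarrow>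
       (\<forall>k. 0 \<le> D k \<and> 0 \<le> M k) \<Longrightarrow> (\<forall>k\<le>n. M k \<le> b) \<Longrightarrow> D n \<le> K"
      using moment_bound[of n b] by blast
    have DK: "D i n \<le> K" for i
      by (rule K[of "D i" "\<lambda>k. LINT s|\<nu>. h i s ^ k"])
         (blast intro: Drec[unfolded M] Dnn Mnn Mb)+
    have mK: "(LINT t|lborel. t ^ n * \<xi> i t) \<le> K" for i
    proof -
      have "D i n / real (Suc n) \<le> D i n / 1" using Dnn by (intro divide_left_mono) auto
      then show ?thesis using DK[of i] mom(2)[of n i] by simp
    qed
    have "(\<integral>\<^sup>+t. ennreal (t ^ n * \<eta> t) \<partial>lborel) \<le> ennreal (2 * K)"
      by (rule moment_of_weak_limit[OF \<xi>(2,4) int \<eta>(1,2,4,5) cdf lim mom(1) mK])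
    then show "(\<integral>\<^sup>+t. ennreal (t ^ n * \<eta> t) \<partial>lborel) < \<infinity>" by (simp add: le_less_trans)
  qed
qed

section \<open>Stieltjes inversion\<close>

lemma integrable_cauchy_kernel:
  assumes z: "0 < Im z" and int: "integrable lborel \<xi>"
  shows "integrable lborel (\<lambda>t. \<xi> t *\<^sub>R (1 / (complex_of_real t - z)))"
proof (rule Bochner_Integration.integrable_bound)
  have [measurable]: "\<xi> \<in> borel_measurable borel" using int by auto
  show "integrable lborel (\<lambda>t. 1 / Im z * \<xi> t)" using int by simp
  show "(\<lambda>t. \<xi> t *\<^sub>R (1 / (complex_of_real t - z))) \<in> borel_measurable lborel" by measurable
  show "AE t in lborel. norm (\<xi> t *\<^sub>R (1 / (complex_of_real t - z))) \<le> norm (1 / Im z * \<xi> t)"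
  proof (rule always_eventually, rule allI)
    fix t
    have "\<bar>\<xi> t\<bar> * cmod (1 / (complex_of_real t - z)) \<le> \<bar>\<xi> t\<bar> * (1 / Im z)"
      by (intro mult_left_mono norm_cauchy_kernel_le z) simp
    then show "norm (\<xi> t *\<^sub>R (1 / (complex_of_real t - z))) \<le> norm (1 / Im z * \<xi> t)" using z by (simp add: abs_mult mult.commute)
  qed
qed

text \<open>
The kernel on the right is the Poisson kernel, normalized to have integral \<open>\<pi>\<close>. Since \<open>\<xi>\<close> is between
\<open>0\<close> and \<open>1\<close>, the imaginary part of the exponent lies between \<open>0\<close> and \<open>\<pi>\<close>, and there the principal
logarithm inverts the exponential function.
\<close>

lemma Im_Ln_exp_phase:
  assumes z: "0 < Im z" and int: "integrable lborel \<xi>" and \<xi>: "\<And>t. 0 \<le> \<xi> t" "\<And>t. \<xi> t \<le> 1"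
  shows "Im (Ln (exp (LINT t|lborel. \<xi> t *\<^sub>R (1 / (complex_of_real t - z))))) =
    (LINT t|lborel. \<xi> t * (Im z / ((t - Re z)\<^sup>2 + (Im z)\<^sup>2)))"
proof -
  define w where "w = (LINT t|lborel. \<xi> t *\<^sub>R (1 / (complex_of_real t - z)))"
  define p where "p t = Im z / ((t - Re z)\<^sup>2 + (Im z)\<^sup>2)" for t
  have p: "integrable lborel p" "(LINT t|lborel. p t) = pi" "0 \<le> p t" for t
    using poisson_kernel[OF z, of "Re z"] z by (auto simp: p_def[abs_def])
  have "Im w = (LINT t|lborel. Im (\<xi> t *\<^sub>R (1 / (complex_of_real t - z))))"
    unfolding w_def by (rule integral_bounded_linear[OF bounded_linear_Im integrable_cauchy_kernel[OF z int], symmetric])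
  also have "\<dots> = (LINT t|lborel. \<xi> t * p t)"
    unfolding p_def Im_cauchy_kernel[symmetric] by simp
  finally have w: "Im w = (LINT t|lborel. \<xi> t * p t)" .
  have pm: "(\<lambda>t. \<xi> t * p t) \<in> borel_measurable lborel"
    using int p(1) by (intro borel_measurable_times borel_measurable_integrable)
  have ip: "integrable lborel (\<lambda>t. \<xi> t * p t)"
    using \<xi> p(3) by (intro Bochner_Integration.integrable_bound[OF p(1) pm])
      (auto simp: abs_mult intro!: always_eventually mult_left_le_one_le)
  have "Im w \<le> pi" unfolding w p(2)[symmetric]
    using \<xi> p(3) by (intro integral_mono ip p(1)) (auto intro: mult_left_le_one_le)
  moreover have "0 \<le> Im w" unfolding w using \<xi> p(3) by (intro integral_nonneg_AE) auto
  ultimately have "Ln (exp w) = w" using pi_gt_zero by (intro Ln_exp) linarith+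
  then show ?thesis using w unfolding w_def p_def by simp
qed

lemma poisson_kernel_arctan:
  assumes y: "0 < y" and ab: "a \<le> b"
  shows "(LINT x|lborel. indicator {a..b} x *\<^sub>R (y / ((t - x)\<^sup>2 + y\<^sup>2))) = arctan ((b - t) / y) - arctan ((a - t) / y)"
proof (rule integral_FTC_atLeastAtMost[OF ab, where F="\<lambda>x. arctan ((x - t) / y)"])
  have pos: "0 < (t - x)\<^sup>2 + y\<^sup>2" for x using y by (simp add: sum_power2_gt_zero_iff)
  show "continuous_on {a..b} (\<lambda>x. y / ((t - x)\<^sup>2 + y\<^sup>2))"
    by (intro continuous_intros ballI) (metis pos less_irrefl)
  fix x
  have "((\<lambda>x. arctan ((x - t) / y)) has_real_derivative (inverse (1 + ((x - t) / y)\<^sup>2) * (1 / y))) (at x)"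
    using y by (auto intro!: derivative_eq_intros simp: divide_simps)
  moreover have "inverse (1 + ((x - t) / y)\<^sup>2) * (1 / y) = y / ((t - x)\<^sup>2 + y\<^sup>2)"
  proof -
    have "1 + ((x - t) / y)\<^sup>2 = ((t - x)\<^sup>2 + y\<^sup>2) / y\<^sup>2" using y by (simp add: power_divide power2_commute field_simps)
    then show ?thesis using y pos[of x] by (simp add: power2_eq_square)
  qed
  ultimately show "((\<lambda>x. arctan ((x - t) / y)) has_vector_derivative y / ((t - x)\<^sup>2 + y\<^sup>2)) (at x within {a..b})"
    by (simp add: has_real_derivative_iff_has_vector_derivative has_vector_derivative_at_within)
qed

lemma arctan_scaled_limit:
  assumes "c \<noteq> 0"
  shows "(\<lambda>n. arctan (c / inverse (real (Suc n)))) \<longlonglongrightarrow> (if 0 < c then pi / 2 else - pi / 2)"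
proof -
  have inv: "c / inverse (real (Suc n)) = c * real (Suc n)" for n by (simp add: divide_inverse del: of_nat_Suc)
  show ?thesis
  proof (cases "0 < c")
    case True
    have "filterlim (\<lambda>n. c * real (Suc n)) at_top sequentially"
      using filterlim_tendsto_pos_mult_at_top[OF tendsto_const True filterlim_compose[OF filterlim_real_sequentially filterlim_Suc]] .
    from filterlim_compose[OF tendsto_arctan_at_top this] show ?thesis unfolding inv using True by simp
  next
    case False
    then have c: "c < 0" using assms by simp
    have "filterlim (\<lambda>n. c * real (Suc n)) at_bot sequentially"
      using filterlim_tendsto_neg_mult_at_bot[OF tendsto_const c filterlim_compose[OF filterlim_real_sequentially filterlim_Suc]] .
    from filterlim_compose[OF tendsto_arctan_at_bot this] show ?thesis unfolding inv using False by simp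
  qed
qed

text \<open>
By Fubini's theorem the left-hand side is the integral of \<open>\<xi>\<close> against a difference of two
arctangents. As the line approaches the real axis, this difference tends to \<open>\<pi>\<close> inside
the interval \<open>{-1..b}\<close> and to \<open>0\<close> outside.
\<close>

lemma stieltjes_inversion:
  assumes int: "integrable lborel \<xi>" and \<xi>: "\<And>t. 0 \<le> \<xi> t" "\<And>t. \<xi> t \<le> 1" "\<forall>t<0. \<xi> t = 0" and b: "0 \<le> b"
  shows "(\<lambda>n. LINT x:{-1..b}|lborel. Im (Ln (exp (LINT t|lborel. \<xi> t *\<^sub>R (1 / (complex_of_real t - Complex x (inverse (real (Suc n)))))))))
    \<longlonglongrightarrow> pi * (LINT t:{..b}|lborel. \<xi> t)"
proof -
  have [measurable]: "\<xi> \<in> borel_measurable borel" using int by auto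
  \<comment> \<open>The left end point only has to be negative, away from the support of \<open>\<xi>\<close>.\<close>
  have le: "-1 \<le> b" using b by simp
  have eq: "(LINT x:{-1..b}|lborel. Im (Ln (exp (LINT t|lborel. \<xi> t *\<^sub>R (1 / (complex_of_real t - Complex x y)))))) =
    (LINT t|lborel. \<xi> t * (arctan ((b - t) / y) - arctan ((-1 - t) / y)))" if y: "0 < y" for y
  proof -
    define f where "f x t = \<xi> t * (indicator {-1..b} x *\<^sub>R (y / ((t - x)\<^sup>2 + y\<^sup>2)))" for x t
    have "integrable (lborel \<Otimes>\<^sub>M lborel) (case_prod f)"
    proof (rule Bochner_Integration.integrable_bound)
      have i: "integrable lborel (indicator {-1..b} :: real \<Rightarrow> real)" using b by (simp add: integrable_indicator_iff)
      have "integrable lborel (\<lambda>x. \<integral>t. norm (indicator {-1..b} x * (\<xi> t / y)) \<partial>lborel)"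
        using int i by (simp add: abs_mult)
      then show "integrable (lborel \<Otimes>\<^sub>M lborel) (\<lambda>(x,t). indicator {-1..b} x * (\<xi> t / y))"
        by (intro lborel_pair.Fubini_integrable) (use int in auto)
      show "case_prod f \<in> borel_measurable (lborel \<Otimes>\<^sub>M lborel)" unfolding f_def by measurable
      have "y / ((t - x)\<^sup>2 + y\<^sup>2) \<le> 1 / y" for t x
      proof -
        have "y / ((t - x)\<^sup>2 + y\<^sup>2) \<le> y / y\<^sup>2" using y by (intro divide_left_mono) (auto simp: add_nonneg_pos)
        also have "\<dots> = 1 / y" using y by (simp add: power2_eq_square)
        finally show ?thesis .
      qed
      then have "\<xi> t * (y / ((t - x)\<^sup>2 + y\<^sup>2)) \<le> \<xi> t * (1 / y)" for t x using \<xi>(1) by (intro mult_left_mono)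
      then show "AE p in lborel \<Otimes>\<^sub>M lborel. norm (case_prod f p) \<le> norm ((\<lambda>(x,t). indicator {-1..b} x * (\<xi> t / y)) p)"
        using y \<xi>(1) by (auto simp: f_def split: split_indicator)
    qed
    then have "(LINT t|lborel. LINT x|lborel. f x t) = (LINT x|lborel. LINT t|lborel. f x t)"
      by (rule lborel_pair.Fubini_integral)
    also have "\<dots> = (LINT x:{-1..b}|lborel. Im (Ln (exp (LINT t|lborel. \<xi> t *\<^sub>R (1 / (complex_of_real t - Complex x y))))))"
    proof -
      have "(LINT t|lborel. f x t) = indicator {-1..b} x *\<^sub>R (LINT t|lborel. \<xi> t * (y / ((t - x)\<^sup>2 + y\<^sup>2)))" for x
        by (simp add: f_def split: split_indicator)
      then show ?thesis
        unfolding set_lebesgue_integral_def using Im_Ln_exp_phase[OF _ int \<xi>(1,2), of "Complex x y" for x] y by simp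
    qed
    finally show ?thesis
      unfolding f_def integral_mult_right_zero poisson_kernel_arctan[OF y le] by simp
  qed
  have "(\<lambda>n. LINT t|lborel. \<xi> t * (arctan ((b - t) / inverse (real (Suc n))) - arctan ((-1 - t) / inverse (real (Suc n)))))
    \<longlonglongrightarrow> (LINT t|lborel. pi * (indicator {..b} t *\<^sub>R \<xi> t))"
  proof (rule integral_dominated_convergence[where w="\<lambda>t. 2 * pi * \<xi> t"])
    show "AE t in lborel. (\<lambda>n. \<xi> t * (arctan ((b - t) / inverse (real (Suc n))) - arctan ((-1 - t) / inverse (real (Suc n)))))
      \<longlonglongrightarrow> pi * (indicator {..b} t *\<^sub>R \<xi> t)"
      using AE_lborel_singleton[of b]
    proof eventually_elim
      fix t assume t: "t \<noteq> b"
      show "(\<lambda>n. \<xi> t * (arctan ((b - t) / inverse (real (Suc n))) - arctan ((-1 - t) / inverse (real (Suc n)))))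
        \<longlonglongrightarrow> pi * (indicator {..b} t *\<^sub>R \<xi> t)"
      proof (cases "t < 0")
        case False
        have "(\<lambda>n. \<xi> t * (arctan ((b - t) / inverse (real (Suc n))) - arctan ((-1 - t) / inverse (real (Suc n)))))
          \<longlonglongrightarrow> \<xi> t * ((if 0 < b - t then pi / 2 else - pi / 2) - (if 0 < - 1 - t then pi / 2 else - pi / 2))"
          using t False by (intro tendsto_mult tendsto_const tendsto_diff arctan_scaled_limit) auto
        also have "\<xi> t * ((if 0 < b - t then pi / 2 else - pi / 2) - (if 0 < - 1 - t then pi / 2 else - pi / 2)) = pi * (indicator {..b} t *\<^sub>R \<xi> t)"
          using t False by (auto simp: indicator_def)
        finally show ?thesis .
      qed (use \<xi>(3) in simp)
    qed
    show "AE t in lborel. norm (\<xi> t * (arctan ((b - t) / inverse (real (Suc n))) - arctan ((-1 - t) / inverse (real (Suc n))))) \<le> 2 * pi * \<xi> t" for n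
    proof (rule always_eventually, rule allI)
      fix t
      have "\<bar>arctan x - arctan x'\<bar> \<le> 2 * pi" for x x'
        using arctan_bounded[of x] arctan_bounded[of x'] by linarith
      then have "\<xi> t * \<bar>arctan ((b - t) / inverse (real (Suc n))) - arctan ((-1 - t) / inverse (real (Suc n)))\<bar> \<le> \<xi> t * (2 * pi)"
        using \<xi>(1) by (intro mult_left_mono)
      then show "norm (\<xi> t * (arctan ((b - t) / inverse (real (Suc n))) - arctan ((-1 - t) / inverse (real (Suc n))))) \<le> 2 * pi * \<xi> t"
        using \<xi>(1) by (simp add: abs_mult mult.commute)
    qed
    show "integrable lborel (\<lambda>t. 2 * pi * \<xi> t)" using int by simp
  qed simp_all
  then show ?thesis
    by (subst eq) (simp_all add: set_lebesgue_integral_def)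
qed

section \<open>Measurable dependence on a parameter\<close>

text \<open>
The measures \<open>\<kappa> y\<close> with density \<open>\<Xi> y\<close> form a kernel of finite measures. Half-lines generate the Borel
sets and are stable under intersection, so measurability in \<open>y\<close> spreads from half-lines
to Borel sets, and from there to nonnegative functions by monotone approximation.
\<close>

lemma measurable_integral_from_cdf:
  fixes \<Xi> :: "'y \<Rightarrow> real \<Rightarrow> real"
  assumes meas: "\<And>y. y \<in> space N \<Longrightarrow> \<Xi> y \<in> borel_measurable borel"
    and nn: "\<And>y t. y \<in> space N \<Longrightarrow> 0 \<le> \<Xi> y t"
    and int: "\<And>y. y \<in> space N \<Longrightarrow> integrable lborel (\<Xi> y)"
    and cdf: "\<And>b. (\<lambda>y. LINT t:{..b}|lborel. \<Xi> y t) \<in> borel_measurable N"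
    and g[measurable]: "g \<in> borel_measurable borel" and gb: "\<And>t. \<bar>g t\<bar> \<le> C"
  shows "(\<lambda>y. LINT t|lborel. \<Xi> y t * g t) \<in> borel_measurable N"
proof -
  define \<kappa> where "\<kappa> y = density lborel (\<lambda>t. ennreal (\<Xi> y t))" for y
  have m: "(\<lambda>t. ennreal (\<Xi> y t)) \<in> borel_measurable lborel" if "y \<in> space N" for y using meas[OF that] by simp
  have s[simp]: "sets (\<kappa> y) = sets borel" "space (\<kappa> y) = UNIV" for y by (simp_all add: \<kappa>_def)
  have fin: "finite_measure (\<kappa> y)" if y: "y \<in> space N" for y
  proof (rule finite_measureI)
    have "emeasure (\<kappa> y) (space (\<kappa> y)) = (\<integral>\<^sup>+t. ennreal (\<Xi> y t) \<partial>lborel)"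
      using m[OF y] by (simp add: \<kappa>_def emeasure_density)
    also have "\<dots> = ennreal (LINT t|lborel. \<Xi> y t)"
      using nn[OF y] int[OF y] by (intro nn_integral_eq_integral) auto
    finally show "emeasure (\<kappa> y) (space (\<kappa> y)) \<noteq> \<infinity>" by simp
  qed
  have base: "(\<lambda>y. emeasure (\<kappa> y) {..b}) \<in> borel_measurable N" for b
  proof -
    have "emeasure (\<kappa> y) {..b} = ennreal (LINT t:{..b}|lborel. \<Xi> y t)" if y: "y \<in> space N" for y
    proof -
      have "emeasure (\<kappa> y) {..b} = (\<integral>\<^sup>+t. ennreal (indicator {..b} t *\<^sub>R \<Xi> y t) \<partial>lborel)"
        using m[OF y] by (auto simp: \<kappa>_def emeasure_density intro!: nn_integral_cong split: split_indicator)
      also have "\<dots> = ennreal (LINT t:{..b}|lborel. \<Xi> y t)"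
        unfolding set_lebesgue_integral_def using nn[OF y] int[OF y]
        by (intro nn_integral_eq_integral integrable_mult_indicator) auto
      finally show ?thesis .
    qed
    then show ?thesis using cdf[of b] by (simp cong: measurable_cong)
  qed
  have total: "(\<lambda>y. emeasure (\<kappa> y) UNIV) \<in> borel_measurable N"
  proof -
    have "emeasure (\<kappa> y) UNIV = (SUP n. emeasure (\<kappa> y) {..real n})" for y
    proof -
      have "(\<Union>n. {..real n}) = UNIV" using real_arch_simple by auto
      then show ?thesis by (subst SUP_emeasure_incseq) (auto simp: incseq_def)
    qed
    then show ?thesis using base by simp
  qed
  have sets: "(\<lambda>y. emeasure (\<kappa> y) A) \<in> borel_measurable N" if "A \<in> sets borel" for A
  proof -
    have "Int_stable (range (\<lambda>b::real. {..b}))" by (auto simp: Int_stable_def)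
    moreover have "range (\<lambda>b::real. {..b}) \<subseteq> Pow UNIV" by simp
    moreover have "A \<in> sigma_sets UNIV (range (\<lambda>b::real. {..b}))"
      using that by (simp add: borel_eq_atMost)
    ultimately show ?thesis
    proof (induction rule: sigma_sets_induct_disjoint)
      case (basic A) then show ?case using base by auto
    next
      case empty then show ?case by simp
    next
      case (compl A)
      then have A: "A \<in> sets borel" by (simp add: borel_eq_atMost)
      have "emeasure (\<kappa> y) (UNIV - A) = emeasure (\<kappa> y) UNIV - emeasure (\<kappa> y) A" if "y \<in> space N" for y
        using emeasure_compl[of A "\<kappa> y"] A finite_measure.emeasure_finite[OF fin[OF that]] by simp
      then show ?case using compl total by (simp cong: measurable_cong)
    next
      case (union A)
      then have "range A \<subseteq> sets borel" by (auto simp: borel_eq_atMost)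
      then have "emeasure (\<kappa> y) (\<Union>i. A i) = (\<Sum>i. emeasure (\<kappa> y) (A i))" for y
        using suminf_emeasure[of A "\<kappa> y"] union by simp
      then show ?case using union by simp
    qed
  qed
  have nnint: "(\<lambda>y. \<integral>\<^sup>+t. f t \<partial>\<kappa> y) \<in> borel_measurable N" if "f \<in> borel_measurable borel" for f
    using that
  proof (induction rule: borel_measurable_induct)
    case (cong f g)
    then show ?case by (simp cong: nn_integral_cong)
  next
    case (set A) then show ?case using sets by simp
  next
    case (mult f c)
    then show ?case by (subst nn_integral_cmult) (auto simp: measurable_cong_sets[OF s(1) refl])
  next
    case (add f g)
    then show ?case by (subst nn_integral_add) (auto simp: measurable_cong_sets[OF s(1) refl])
  next
    case (seq U)
    then show ?case
      by (simp add: SUP_apply[abs_def] image_comp) (subst nn_integral_monotone_convergence_SUP, auto simp: measurable_cong_sets[OF s(1) refl])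
  qed
  have "(LINT t|lborel. \<Xi> y t * g t) = enn2real (\<integral>\<^sup>+t. ennreal (g t) \<partial>\<kappa> y) - enn2real (\<integral>\<^sup>+t. ennreal (- g t) \<partial>\<kappa> y)"
    if y: "y \<in> space N" for y
  proof -
    have "(LINT t|lborel. \<Xi> y t * g t) = (LINT t|\<kappa> y. g t)"
      unfolding \<kappa>_def using meas[OF y] nn[OF y] by (subst integral_density) auto
    also have "integrable (\<kappa> y) g"
      using fin[OF y] gb by (intro finite_measure.integrable_const_bound[of _ _ C]) (auto simp: measurable_cong_sets[OF s(1) refl])
    then have "(LINT t|\<kappa> y. g t) = enn2real (\<integral>\<^sup>+t. ennreal (g t) \<partial>\<kappa> y) - enn2real (\<integral>\<^sup>+t. ennreal (- g t) \<partial>\<kappa> y)"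
      by (rule real_lebesgue_integral_def)
    finally show ?thesis .
  qed
  moreover have "(\<lambda>y. enn2real (\<integral>\<^sup>+t. ennreal (g t) \<partial>\<kappa> y) - enn2real (\<integral>\<^sup>+t. ennreal (- g t) \<partial>\<kappa> y)) \<in> borel_measurable N"
    using nnint[of "\<lambda>t. ennreal (g t)"] nnint[of "\<lambda>t. ennreal (- g t)"] by simp
  ultimately show ?thesis by (simp cong: measurable_cong)
qed

section \<open>Cones\<close>

lemma half_line_integrals:
  fixes f :: "real \<Rightarrow> 'a::{banach, second_countable_topology}"
  assumes f: "f \<in> borel_measurable borel" and neg: "\<forall>t<0. f t = 0"
  shows "integrable half_line f \<longleftrightarrow> integrable lborel f" "(LINT t|half_line. f t) = (LINT t|lborel. f t)"
proof -
  have eq: "(\<lambda>t. indicator {0..} t *\<^sub>R f t) = f" using neg by (auto simp: indicator_def fun_eq_iff)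
  show "integrable half_line f \<longleftrightarrow> integrable lborel f"
    using f by (simp add: integrable_restrict_space eq integrable_completion)
  show "(LINT t|half_line. f t) = (LINT t|lborel. f t)"
    using f by (simp add: integral_restrict_space eq integral_completion)
qed

text \<open>
An essentially bounded Lebesgue measurable function is almost everywhere equal to a bounded Borel function, which
can be tested against Borel measurable phases.
\<close>

lemma half_line_integral_L_infinity:
  assumes g: "g \<in> L_infinity half_line"
  obtains g' C where "g' \<in> borel_measurable borel" "\<And>t. \<bar>g' t\<bar> \<le> C"
    "\<forall>\<xi>\<in>borel_measurable borel. (\<forall>t<0. \<xi> t = 0) \<longrightarrow> (LINT t|half_line. \<xi> t * g t) = (LINT t|lborel. \<xi> t * g' t)"
proof -
  obtain C where gm: "g \<in> borel_measurable half_line" and C: "AE t in half_line. \<bar>g t\<bar> \<le> C"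
    using g by (auto simp: L_infinity_def)
  have g0: "(\<lambda>t. indicator {0..} t *\<^sub>R g t) \<in> borel_measurable lebesgue"
    using gm by (simp add: borel_measurable_restrict_space_iff)
  then obtain g1 where g1[measurable]: "g1 \<in> borel_measurable borel" and ae: "AE t in lborel. indicator {0..} t *\<^sub>R g t = g1 t"
    using completion_ex_borel_measurable_real[OF g0] by auto
  \<comment> \<open>Clamping gives a bound everywhere without changing the values where \<open>\<bar>g t\<bar> \<le> C\<close>.\<close>
  define g' where "g' t = max (- \<bar>C\<bar>) (min \<bar>C\<bar> (g1 t))" for t
  have g'[measurable]: "g' \<in> borel_measurable borel" unfolding g'_def by measurable
  have ae': "AE t in lebesgue. 0 \<le> t \<longrightarrow> \<bar>g t\<bar> \<le> C"
    using C by (simp add: AE_restrict_space_iff)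
  show ?thesis
  proof (rule that[OF g', of "\<bar>C\<bar>"])
    show "\<bar>g' t\<bar> \<le> \<bar>C\<bar>" for t unfolding g'_def by linarith
    show "\<forall>\<xi>\<in>borel_measurable borel. (\<forall>t<0. \<xi> t = 0) \<longrightarrow> (LINT t|half_line. \<xi> t * g t) = (LINT t|lborel. \<xi> t * g' t)"
    proof (intro ballI impI)
      fix \<xi> :: "real \<Rightarrow> real" assume \<xi>[measurable]: "\<xi> \<in> borel_measurable borel" and neg: "\<forall>t<0. \<xi> t = 0"
      have m: "(\<lambda>t. \<xi> t * g' t) \<in> borel_measurable lborel" by measurable
      have "(LINT t|half_line. \<xi> t * g t) = (LINT t|lebesgue. indicator {0..} t *\<^sub>R (\<xi> t * g t))"
        by (simp add: integral_restrict_space)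
      also have "\<dots> = (LINT t|lebesgue. \<xi> t * g' t)"
      proof (rule integral_cong_AE)
        have "\<xi> \<in> borel_measurable lebesgue" by (rule measurable_completion) simp
        from borel_measurable_times[OF this g0]
        have "(\<lambda>t. \<xi> t * (indicator {0..} t *\<^sub>R g t)) \<in> borel_measurable lebesgue" .
        then show "(\<lambda>t. indicator {0..} t *\<^sub>R (\<xi> t * g t)) \<in> borel_measurable lebesgue"
          by (simp add: mult.left_commute)
        show "(\<lambda>t. \<xi> t * g' t) \<in> borel_measurable lebesgue" using m by (rule measurable_completion)
        show "AE t in lebesgue. indicator {0..} t *\<^sub>R (\<xi> t * g t) = \<xi> t * g' t"
          using AE_completion[OF ae] ae'
        proof eventually_elim
          fix t assume "indicator {0..} t *\<^sub>R g t = g1 t" "0 \<le> t \<longrightarrow> \<bar>g t\<bar> \<le> C"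
          then show "indicator {0..} t *\<^sub>R (\<xi> t * g t) = \<xi> t * g' t"
            using neg by (cases "t < 0") (auto simp: g'_def)
        qed
      qed
      also have "\<dots> = (LINT t|lborel. \<xi> t * g' t)" using m by (rule integral_completion)
      finally show "(LINT t|half_line. \<xi> t * g t) = (LINT t|lborel. \<xi> t * g' t)" .
    qed
  qed
qed

lemma closed_polar_cone: "closed (polar_cone S)"
proof -
  have "polar_cone S = (\<Inter>w\<in>S. {x. 0 \<le> w \<bullet> x})" by (auto simp: polar_cone_def)
  moreover have "closed {x. 0 \<le> w \<bullet> x}" for w :: 'a
    by (intro closed_Collect_le continuous_intros)
  ultimately show ?thesis by auto
qed

theorem theorem9:
  fixes \<Gamma> :: "(real ^ 'd) set" and \<mu> :: "(real ^ 'd) measure"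
  assumes "convex_cone \<Gamma>" and "closed \<Gamma>" and "solid \<Gamma>" and "acute \<Gamma>"
    and "sets \<mu> = sets borel" and "finite_measure \<mu>"
    and "emeasure \<mu> (- polar_cone \<Gamma>) = 0"
  shows "\<exists>\<xi> :: real ^ 'd \<Rightarrow> real \<Rightarrow> real.
    (\<forall>y\<in>\<Gamma>. phase_function (\<xi> y)) \<and>
    weakly_measurable_on \<Gamma> \<xi> \<and>
    (\<forall>y\<in>\<Gamma>. \<forall>z::complex. Im z > 0 \<longrightarrow>
      1 + (LINT x:polar_cone \<Gamma>|\<mu>. 1 / (complex_of_real (x \<bullet> y) - z)) =
      exp (LINT t|half_line. complex_of_real (\<xi> y t) / (complex_of_real t - z))) \<and>
    (\<forall>n::nat. (\<integral>\<^sup>+x\<in>polar_cone \<Gamma>. ennreal (norm x ^ n) \<partial>\<mu>) < \<infinity> \<longrightarrow>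
      (\<forall>y\<in>\<Gamma>. (\<integral>\<^sup>+t. ennreal (t ^ n * \<xi> y t) \<partial>half_line) < \<infinity>))"
proof -
  note s\<mu>[measurable_cong] = assms(5)
  interpret \<mu>: finite_measure \<mu> by fact
  have pm[measurable]: "polar_cone \<Gamma> \<in> sets borel" by (rule borel_closed[OF closed_polar_cone])
  have supp: "AE x in \<mu>. x \<in> polar_cone \<Gamma>"
    by (rule AE_I[OF _ assms(7)]) (auto simp: assms(5))
  define \<nu> where "\<nu> y = distr \<mu> borel (\<lambda>x. x \<bullet> y)" for y
  define F where "F y z = 1 + (LINT x|\<mu>. 1 / (complex_of_real (x \<bullet> y) - z))" for y z
  have F\<nu>: "F y z = 1 + (LINT s|\<nu> y. 1 / (complex_of_real s - z))" for y z
    unfolding F_def \<nu>_def by (subst integral_distr) auto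
  have Fset: "1 + (LINT x:polar_cone \<Gamma>|\<mu>. 1 / (complex_of_real (x \<bullet> y) - z)) = F y z" for y z
    unfolding F_def set_lebesgue_integral_def
    by (intro arg_cong[where f="\<lambda>c. 1 + c"] integral_cong_AE) (use supp in \<open>auto elim!: eventually_mono\<close>)
  define P where "P y \<xi> \<longleftrightarrow> \<xi> \<in> borel_measurable borel \<and> (\<forall>t. 0 \<le> \<xi> t) \<and> (\<forall>t. \<xi> t \<le> 1) \<and> (\<forall>t<0. \<xi> t = 0) \<and> integrable lborel \<xi> \<and>
    (\<forall>z. 0 < Im z \<longrightarrow> F y z = exp (LINT t|lborel. \<xi> t *\<^sub>R (1 / (complex_of_real t - z)))) \<and>
    (\<forall>n. integrable (\<nu> y) (\<lambda>s. s ^ n) \<longrightarrow> (\<integral>\<^sup>+t. ennreal (t ^ n * \<xi> t) \<partial>lborel) < \<infinity>)" for y \<xi>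
  have "\<exists>\<xi>. P y \<xi>" if y: "y \<in> \<Gamma>" for y
  proof -
    have 1: "sets (\<nu> y) = sets borel" by (simp add: \<nu>_def)
    have 2: "finite_measure (\<nu> y)" unfolding \<nu>_def by (rule \<mu>.finite_measure_distr) simp
    have 3: "AE s in \<nu> y. 0 \<le> s"
      unfolding \<nu>_def using supp y
      by (subst AE_distr_iff) (auto elim!: eventually_mono simp: polar_cone_def inner_commute)
    show ?thesis unfolding P_def F\<nu> by (rule stieltjes_phase[OF 1 2 3]) blast
  qed
  then have "\<forall>y\<in>\<Gamma>. \<exists>\<xi>. P y \<xi>" by blast
  from bchoice[OF this] obtain \<xi> where P: "\<And>y. y \<in> \<Gamma> \<Longrightarrow> P y (\<xi> y)" by blast
  have \<xi>: "\<xi> y \<in> borel_measurable borel" "0 \<le> \<xi> y t" "\<xi> y t \<le> 1" "\<forall>t<0. \<xi> y t = 0" "integrable lborel (\<xi> y)" if "y \<in> \<Gamma>" for y t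
    using P[OF that] unfolding P_def by blast+
  have rep: "F y z = exp (LINT t|lborel. \<xi> y t *\<^sub>R (1 / (complex_of_real t - z)))" if "y \<in> \<Gamma>" "0 < Im z" for y z
    using P[OF that(1)] that(2) unfolding P_def by blast
  have mom: "(\<integral>\<^sup>+t. ennreal (t ^ n * \<xi> y t) \<partial>lborel) < \<infinity>" if "y \<in> \<Gamma>" "integrable (\<nu> y) (\<lambda>s. s ^ n)" for y n
    using P[OF that(1)] that(2) unfolding P_def by blast
  define N :: "(real ^ 'd) measure" where "N = restrict_space borel \<Gamma>"
  have sN: "space N = \<Gamma>" by (simp add: N_def space_restrict_space)
  have cdf: "(\<lambda>y. LINT t:{..b}|lborel. \<xi> y t) \<in> borel_measurable N" for b
  proof (cases "0 \<le> b")
    case True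
    \<comment> \<open>Approximate distribution functions that involve \<open>F\<close> alone and not the chosen phase.\<close>
    define H where "H n y = (LINT x:{-1..b}|lborel. Im (Ln (F y (Complex x (inverse (real (Suc n)))))))" for n y
    have Hm: "H n \<in> borel_measurable N" for n
    proof -
      have Fm: "(\<lambda>p. F (fst p) (Complex (snd p) e)) \<in> borel_measurable (borel \<Otimes>\<^sub>M lborel)" for e
        unfolding F_def Complex_eq by measurable
      have "(\<lambda>y. LINT x|lborel. indicator {-1..b} x *\<^sub>R Im (Ln (F y (Complex x e)))) \<in> borel_measurable borel" for e
      proof (rule lborel.borel_measurable_lebesgue_integral)
        have "(\<lambda>p. Im (Ln (F (fst p) (Complex (snd p) e)))) \<in> borel_measurable (borel \<Otimes>\<^sub>M lborel)"
          using measurable_compose[OF measurable_compose[OF Fm Ln_measurable] borel_measurable_Im] .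
        then show "(\<lambda>(y, x). indicator {-1..b} x *\<^sub>R Im (Ln (F y (Complex x e)))) \<in> borel_measurable (borel \<Otimes>\<^sub>M lborel)"
          by (simp add: case_prod_beta')
      qed
      then show ?thesis unfolding H_def[abs_def] set_lebesgue_integral_def N_def by (intro measurable_restrict_space1)
    qed
    have lim: "(\<lambda>n. H n y / pi) \<longlonglongrightarrow> (LINT t:{..b}|lborel. \<xi> y t)" if "y \<in> space N" for y
    proof -
      have y: "y \<in> \<Gamma>" using that by (simp add: sN)
      have "(\<lambda>n. H n y) \<longlonglongrightarrow> pi * (LINT t:{..b}|lborel. \<xi> y t)"
        using stieltjes_inversion[OF \<xi>(5)[OF y] \<xi>(2)[OF y] \<xi>(3)[OF y] \<xi>(4)[OF y] True] unfolding H_def by (simp add: rep[OF y])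
      from tendsto_divide[OF this tendsto_const[of pi]] show ?thesis by simp
    qed
    have "(\<lambda>y. H n y / pi) \<in> borel_measurable N" for n
      by (intro borel_measurable_divide Hm borel_measurable_const)
    with lim show ?thesis by (rule borel_measurable_LIMSEQ_real)
  next
    case False
    have "(LINT t:{..b}|lborel. \<xi> y t) = 0" if "y \<in> space N" for y
    proof -
      have "(\<lambda>t. indicator {..b} t *\<^sub>R \<xi> y t) = (\<lambda>_. 0)"
        using False \<xi>(4)[of y] that by (auto simp: sN indicator_def fun_eq_iff)
      then show ?thesis unfolding set_lebesgue_integral_def by simp
    qed
    then show ?thesis by (simp cong: measurable_cong)
  qed
  show ?thesis
  proof (intro exI conjI ballI allI impI)
    fix y assume y: "y \<in> \<Gamma>"
    show "phase_function (\<xi> y)"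
      unfolding phase_function_def using \<xi>[OF y] half_line_integrals(1)[of "\<xi> y"] by blast
    fix z :: complex assume z: "0 < Im z"
    have "(LINT t|half_line. complex_of_real (\<xi> y t) / (complex_of_real t - z)) = (LINT t|lborel. complex_of_real (\<xi> y t) / (complex_of_real t - z))"
      using \<xi>(1,4)[OF y] by (intro half_line_integrals) auto
    then show "1 + (LINT x:polar_cone \<Gamma>|\<mu>. 1 / (complex_of_real (x \<bullet> y) - z)) =
      exp (LINT t|half_line. complex_of_real (\<xi> y t) / (complex_of_real t - z))"
      unfolding Fset rep[OF y z] by (simp add: scaleR_conv_of_real)
  next
    show "weakly_measurable_on \<Gamma> \<xi>"
      unfolding weakly_measurable_on_def
    proof
      fix g assume "g \<in> L_infinity half_line"
      then obtain g' C where g': "g' \<in> borel_measurable borel" "\<And>t. \<bar>g' t\<bar> \<le> C"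
        and eq: "\<forall>\<zeta>\<in>borel_measurable borel. (\<forall>t<0. \<zeta> t = 0) \<longrightarrow> (LINT t|half_line. \<zeta> t * g t) = (LINT t|lborel. \<zeta> t * g' t)"
        by (rule half_line_integral_L_infinity) (rule that)
      have "(\<lambda>y. LINT t|lborel. \<xi> y t * g' t) \<in> borel_measurable N"
        by (rule measurable_integral_from_cdf[OF _ _ _ cdf g']) (auto simp: sN \<xi>)
      moreover have "(LINT t|half_line. \<xi> y t * g t) = (LINT t|lborel. \<xi> y t * g' t)" if "y \<in> space N" for y
        using bspec[OF eq \<xi>(1)] \<xi>(4) that by (simp add: sN)
      ultimately show "(\<lambda>y. LINT t|half_line. \<xi> y t * g t) \<in> borel_measurable (restrict_space borel \<Gamma>)"
        unfolding N_def[symmetric] by (simp cong: measurable_cong)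
    qed
  next
    fix n y assume fin: "(\<integral>\<^sup>+x\<in>polar_cone \<Gamma>. ennreal (norm x ^ n) \<partial>\<mu>) < \<infinity>" and y: "y \<in> \<Gamma>"
    have "integrable \<mu> (\<lambda>x. norm x ^ n)"
    proof (rule integrableI_nonneg)
      have "(\<integral>\<^sup>+x. ennreal (norm x ^ n) \<partial>\<mu>) = (\<integral>\<^sup>+x\<in>polar_cone \<Gamma>. ennreal (norm x ^ n) \<partial>\<mu>)"
        by (rule nn_integral_cong_AE) (use supp in \<open>auto elim!: eventually_mono\<close>)
      then show "(\<integral>\<^sup>+x. ennreal (norm x ^ n) \<partial>\<mu>) < \<infinity>" using fin by simp
    qed auto
    then have "integrable \<mu> (\<lambda>x. norm y ^ n * norm x ^ n)" by simp
    then have "integrable \<mu> (\<lambda>x. (x \<bullet> y) ^ n)"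
    proof (rule Bochner_Integration.integrable_bound)
      have "\<bar>x \<bullet> y\<bar> ^ n \<le> (norm x * norm y) ^ n" for x
        by (intro power_mono Cauchy_Schwarz_ineq2) simp
      then show "AE x in \<mu>. norm ((x \<bullet> y) ^ n) \<le> norm (norm y ^ n * norm x ^ n)"
        by (auto simp: power_abs power_mult_distrib mult.commute abs_mult)
    qed simp
    then have "integrable (\<nu> y) (\<lambda>s. s ^ n)" unfolding \<nu>_def by (subst integrable_distr_eq) auto
    from mom[OF y this] have "(\<integral>\<^sup>+t. ennreal (t ^ n * \<xi> y t) \<partial>lborel) < \<infinity>" .
    moreover have "(\<integral>\<^sup>+t. ennreal (t ^ n * \<xi> y t) \<partial>half_line) = (\<integral>\<^sup>+t. ennreal (t ^ n * \<xi> y t) \<partial>lborel)"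
    proof -
      have "(\<integral>\<^sup>+t. ennreal (t ^ n * \<xi> y t) \<partial>half_line) = (\<integral>\<^sup>+t. ennreal (t ^ n * \<xi> y t) * indicator {0..} t \<partial>lebesgue)"
        by (rule nn_integral_restrict_space) simp
      also have "\<dots> = (\<integral>\<^sup>+t. ennreal (t ^ n * \<xi> y t) \<partial>lebesgue)"
        using \<xi>(4)[OF y] by (intro nn_integral_cong) (auto simp: indicator_def)
      finally show ?thesis using \<xi>(1)[OF y] by (simp add: nn_integral_completion)
    qed
    ultimately show "(\<integral>\<^sup>+t. ennreal (t ^ n * \<xi> y t) \<partial>half_line) < \<infinity>" by simp
  qed
qed

end
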